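(* Let $\mathfrak m=\mathfrak m(V,W,\beta)$ be an extended translation algebra over $\mathbb K=\mathbb R$ or $\mathbb C$, and let $\mathfrak g=\sum_{p}\mathfrak g_p$ be its maximal transitive prolongation. Then the Lie algebra $\mathfrak g_0$ is a direct sum of ideals $$\mathfrak g_0=\mathfrak{so}(V)\oplus\mathbb K E\oplus\mathfrak h_0 .$$
   Context: Let $\mathbb K=\mathbb R$ or $\mathbb C$ and let $V\neq0$ be a finite-dimensional $\mathbb K$-vector space with a nondegenerate (possibly indefinite in the real case) symmetric bilinear form $(\cdot,\cdot)$. The Clifford algebra $C\!\ell(V)$ has product satisfying $vu+uv=-2(v,u)\mathbf 1$ for $v,u\in V$. Let $W\ne0$ be a finite-dimensional $C\!\ell(V)$-module, with action written $c\cdot s$. The Lie algebra $\mathfrak{so}(V)$ acts on $V$ in the defining way and on $W$ by the spin representation, i.e. the endomorphism $w\mapsto (v,w)u-(u,w)v$ acts on $W$ as $\frac14(vu-uv)\in C\!\ell(V)$. Let $\beta$ be a nondegenerate bilinear form on $W$ such that: (B1) $\beta$ is $\mathfrak{so}(V)$-invariant; (B2) $\beta$ is symmetric (put $\epsilon=-1$) or skew-symmetric (put $\epsilon=1$); (B3) $\beta(v\cdot s,t)=\epsilon\beta(s,v\cdot t)$ for all $v\in V$, $s,t\in W$. The extended translation algebra $\mathfrak m=\mathfrak m(V,W,\beta)$ is the graded Lie algebra $\mathfrak m=\mathfrak m_{-2}+\mathfrak m_{-1}$, $\mathfrak m_{-2}=V$, $\mathfrak m_{-1}=W$, whose only nonzero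 bracket $W\times W\to V$ is given by $([s,t],v)=\beta(v\cdot s,t)$. The maximal transitive prolongation of $\mathfrak m$ is the (unique) graded Lie algebra $\mathfrak g=\sum_{p\in\mathbb Z}\mathfrak g_p$ such that (1) each $\mathfrak g_p$ is finite-dimensional; (2) the negatively graded part of $\mathfrak g$ is $\mathfrak m$ ($\mathfrak g_p=\mathfrak m_p$ for $p=-1,-2$ and $\mathfrak g_p=0$ for $p<-2$); (3) for all $p\ge0$, $X\in\mathfrak g_p$ with $[X,\mathfrak g_{-1}]=0$ implies $X=0$; (4) $\mathfrak g$ is maximal: any graded Lie algebra $\mathfrak g'$ satisfying (1)-(3) admits an injective graded Lie algebra homomorphism $\mathfrak g'\to\mathfrak g$. In particular $\mathfrak g_0$ is the Lie algebra of all degree-$0$ derivations of $\mathfrak m$. The algebra $\mathfrak{so}(V)$ is regarded as a subalgebra of $\mathfrak g_0$ through its actions on $V$ and $W$; $E\in\mathfrak g_0$ is the grading element, i.e. the derivation acting as $-1$ on $W$ and $-2$ on $V$; and $\mathfrak h_0=\{D\in\mathfrak g_0\mid [D,v]=0\ \forall v\in V\}$. *)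

theory Defs
  imports Complex_Main "HOL-Library.Poly_Mapping" "HOL-Library.Product_Plus"
begin

section \<open>The ground field\<close>

text \<open>The ground field is a type \<open>'k\<close> that is isomorphic, as a field, to the real or to the
  complex numbers. No topology on it is used.\<close>

definition field_iso :: "('a::field \<Rightarrow> 'b::field) \<Rightarrow> bool" where
  "field_iso f \<longleftrightarrow> bij f \<and> f 1 = 1 \<and>
     (\<forall>x y. f (x + y) = f x + f y) \<and> (\<forall>x y. f (x * y) = f x * f y)"

definition real_or_complex :: "'k::field itself \<Rightarrow> bool" where
  "real_or_complex (_ :: 'k itself) \<longleftrightarrow>
     (\<exists>f :: 'k \<Rightarrow> real. field_iso f) \<or> (\<exists>f :: 'k \<Rightarrow> complex. field_iso f)"

definition fin_dim :: "('k::field \<Rightarrow> 'a::ab_group_add \<Rightarrow> 'a) \<Rightarrow> 'a set \<Rightarrow> bool" where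
  "fin_dim scale S \<longleftrightarrow> (\<exists>B. finite B \<and> S = module.span scale B)"


section \<open>The Clifford algebra\<close>

text \<open>The free monoid on \<open>'v\<close>; finitely supported functions on it, with the convolution product
  of \<^theory>\<open>HOL-Library.Poly_Mapping\<close>, form the free associative unital algebra on \<open>'v\<close>.\<close>

datatype 'v free_monoid = Word "'v list"

instantiation free_monoid :: (type) monoid_add
begin

definition zero_free_monoid :: "'a free_monoid" where
  "0 = Word []"

fun plus_free_monoid :: "'a free_monoid \<Rightarrow> 'a free_monoid \<Rightarrow> 'a free_monoid" where
  "Word xs + Word ys = Word (xs @ ys)"

instance
proof
  fix a b c :: "'a free_monoid"
  show "a + b + c = a + (b + c)" by (cases a; cases b; cases c) simp
  show "0 + a = a" by (cases a) (simp add: zero_free_monoid_def)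
  show "a + 0 = a" by (cases a) (simp add: zero_free_monoid_def)
qed

end

type_synonym ('v, 'k) free_algebra = "'v free_monoid \<Rightarrow>\<^sub>0 'k"

definition gen :: "'v \<Rightarrow> ('v, 'k::field) free_algebra" where
  "gen v = Poly_Mapping.single (Word [v]) 1"

definition const :: "'k::field \<Rightarrow> ('v, 'k) free_algebra" where
  "const c = Poly_Mapping.single 0 c"

text \<open>The two-sided ideal of the free algebra on the set \<open>V\<close> whose quotient is the Clifford
  algebra of \<open>(V, form)\<close>: the rules \<open>additive\<close> and \<open>homogeneous\<close> cut the free algebra down to
  the tensor algebra of the vector space \<open>V\<close>, and the rule \<open>clifford\<close> imposes
  \<open>vu + uv = -2(v,u)1\<close>.\<close>

inductive_set clifford_ideal ::
    "('k::field \<Rightarrow> 'v::ab_group_add \<Rightarrow> 'v) \<Rightarrow> ('v \<Rightarrow> 'v \<Rightarrow> 'k) \<Rightarrow> ('v, 'k) free_algebra set"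
  for scaleV :: "'k::field \<Rightarrow> 'v::ab_group_add \<Rightarrow> 'v" and form :: "'v \<Rightarrow> 'v \<Rightarrow> 'k" where
  additive: "gen (v + u) - gen v - gen u \<in> clifford_ideal scaleV form"
| homogeneous: "gen (scaleV c v) - const c * gen v \<in> clifford_ideal scaleV form"
| clifford: "gen v * gen u + gen u * gen v + const (2 * form v u) \<in> clifford_ideal scaleV form"
| sum: "x \<in> clifford_ideal scaleV form \<Longrightarrow> y \<in> clifford_ideal scaleV form
    \<Longrightarrow> x + y \<in> clifford_ideal scaleV form"
| mult: "x \<in> clifford_ideal scaleV form \<Longrightarrow> a * x * b \<in> clifford_ideal scaleV form"

text \<open>Elements of the Clifford algebra are the cosets \<open>cl x\<close>; its operations are those induced
  from representatives, so that \<open>cl x + cl y = cl (x + y)\<close> and \<open>cl x * cl y = cl (x * y)\<close>.\<close>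

definition clifford_class ::
    "('k::field \<Rightarrow> 'v::ab_group_add \<Rightarrow> 'v) \<Rightarrow> ('v \<Rightarrow> 'v \<Rightarrow> 'k) \<Rightarrow> ('v, 'k) free_algebra
      \<Rightarrow> ('v, 'k) free_algebra set" where
  "clifford_class scaleV form x = {y. y - x \<in> clifford_ideal scaleV form}"

lemma clifford_class_eqI:
  assumes "x - y \<in> clifford_ideal scaleV form"
  shows "clifford_class scaleV form x = clifford_class scaleV form y"
proof -
  have neg: "y - x \<in> clifford_ideal scaleV form"
    using clifford_ideal.mult[OF assms, of "-1" 1] by simp
  show ?thesis
    unfolding clifford_class_def
  proof (intro Collect_cong iffI)
    fix z
    show "z - y \<in> clifford_ideal scaleV form" if "z - x \<in> clifford_ideal scaleV form"
      using clifford_ideal.sum[OF that assms] by simp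
    show "z - x \<in> clifford_ideal scaleV form" if "z - y \<in> clifford_ideal scaleV form"
      using clifford_ideal.sum[OF that neg] by simp
  qed
qed


section \<open>Graded Lie algebras\<close>

text \<open>The Lie algebra is the sum of the subspaces \<open>gr p\<close> of the ambient vector space; only the
  restriction of \<open>br\<close> to it matters.\<close>

definition graded_space ::
    "('k::field \<Rightarrow> 'g::ab_group_add \<Rightarrow> 'g) \<Rightarrow> (int \<Rightarrow> 'g set) \<Rightarrow> 'g set" where
  "graded_space scale gr = module.span scale (\<Union>p. gr p)"

locale graded_lie_algebra = vector_space scale
  for scale :: "'k::field \<Rightarrow> 'g::ab_group_add \<Rightarrow> 'g" +
  fixes br :: "'g \<Rightarrow> 'g \<Rightarrow> 'g" and gr :: "int \<Rightarrow> 'g set"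
  assumes gr_subspace: "subspace (gr p)"
    and gr_independent: "finite P \<Longrightarrow> (\<And>p. p \<in> P \<Longrightarrow> f p \<in> gr p) \<Longrightarrow> (\<Sum>p\<in>P. f p) = 0
      \<Longrightarrow> p \<in> P \<Longrightarrow> f p = 0"
    and br_gr: "x \<in> gr p \<Longrightarrow> y \<in> gr q \<Longrightarrow> br x y \<in> gr (p + q)"
    and br_add_left: "\<lbrakk>x \<in> graded_space scale gr; y \<in> graded_space scale gr;
      z \<in> graded_space scale gr\<rbrakk> \<Longrightarrow> br (x + y) z = br x z + br y z"
    and br_scale_left: "\<lbrakk>x \<in> graded_space scale gr; y \<in> graded_space scale gr\<rbrakk>
      \<Longrightarrow> br (scale c x) y = scale c (br x y)"
    and br_add_right: "\<lbrakk>x \<in> graded_space scale gr; y \<in> graded_space scale gr;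
      z \<in> graded_space scale gr\<rbrakk> \<Longrightarrow> br x (y + z) = br x y + br x z"
    and br_scale_right: "\<lbrakk>x \<in> graded_space scale gr; y \<in> graded_space scale gr\<rbrakk>
      \<Longrightarrow> br x (scale c y) = scale c (br x y)"
    and br_self: "x \<in> graded_space scale gr \<Longrightarrow> br x x = 0"
    and jacobi: "\<lbrakk>x \<in> graded_space scale gr; y \<in> graded_space scale gr;
      z \<in> graded_space scale gr\<rbrakk> \<Longrightarrow> br x (br y z) + br y (br z x) + br z (br x y) = 0"

definition graded_lie_hom ::
    "('k::field \<Rightarrow> 'g::ab_group_add \<Rightarrow> 'g) \<Rightarrow> ('g \<Rightarrow> 'g \<Rightarrow> 'g) \<Rightarrow> (int \<Rightarrow> 'g set)
      \<Rightarrow> ('k \<Rightarrow> 'h::ab_group_add \<Rightarrow> 'h) \<Rightarrow> ('h \<Rightarrow> 'h \<Rightarrow> 'h) \<Rightarrow> (int \<Rightarrow> 'h set)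
      \<Rightarrow> ('g \<Rightarrow> 'h) \<Rightarrow> bool" where
  "graded_lie_hom scale br gr scale' br' gr' f \<longleftrightarrow>
     (\<forall>x\<in>graded_space scale gr. \<forall>y\<in>graded_space scale gr. f (x + y) = f x + f y) \<and>
     (\<forall>c. \<forall>x\<in>graded_space scale gr. f (scale c x) = scale' c (f x)) \<and>
     (\<forall>x\<in>graded_space scale gr. \<forall>y\<in>graded_space scale gr. f (br x y) = br' (f x) (f y)) \<and>
     (\<forall>p. f ` gr p \<subseteq> gr' p)"

definition lie_ideal ::
    "('k::field \<Rightarrow> 'g::ab_group_add \<Rightarrow> 'g) \<Rightarrow> ('g \<Rightarrow> 'g \<Rightarrow> 'g) \<Rightarrow> 'g set \<Rightarrow> 'g set \<Rightarrow> bool" where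
  "lie_ideal scale br L I \<longleftrightarrow>
     I \<subseteq> L \<and> module.subspace scale I \<and> (\<forall>x\<in>L. \<forall>y\<in>I. br x y \<in> I)"

definition direct_sum_of_three_ideals ::
    "('k::field \<Rightarrow> 'g::ab_group_add \<Rightarrow> 'g) \<Rightarrow> ('g \<Rightarrow> 'g \<Rightarrow> 'g) \<Rightarrow> 'g set
      \<Rightarrow> 'g set \<Rightarrow> 'g set \<Rightarrow> 'g set \<Rightarrow> bool" where
  "direct_sum_of_three_ideals scale br L I J K \<longleftrightarrow>
     lie_ideal scale br L I \<and> lie_ideal scale br L J \<and> lie_ideal scale br L K \<and>
     (\<forall>x\<in>L. \<exists>!(a, b, c). a \<in> I \<and> b \<in> J \<and> c \<in> K \<and> x = a + b + c)"


section \<open>Extended translation algebras\<close>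

locale quadratic_space = V: vector_space scaleV
  for scaleV :: "'k::field \<Rightarrow> 'v::ab_group_add \<Rightarrow> 'v" +
  fixes form :: "'v \<Rightarrow> 'v \<Rightarrow> 'k"
  assumes V_fin_dim: "fin_dim scaleV UNIV"
    and V_nonzero: "\<exists>v :: 'v. v \<noteq> 0"
    and form_add: "form (v + v') u = form v u + form v' u"
    and form_scale: "form (scaleV c v) u = c * form v u"
    and form_sym: "form v u = form u v"
    and form_nondegenerate: "(\<And>u. form v u = 0) \<Longrightarrow> v = 0"
begin

abbreviation cl :: "('v, 'k) free_algebra \<Rightarrow> ('v, 'k) free_algebra set" where
  "cl \<equiv> clifford_class scaleV form"

definition so :: "('v \<Rightarrow> 'v) set" where
  "so = {A. Vector_Spaces.linear scaleV scaleV A \<and> (\<forall>v u. form (A v) u + form v (A u) = 0)}"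

definition wedge :: "'v \<Rightarrow> 'v \<Rightarrow> 'v \<Rightarrow> 'v" where
  "wedge v u = (\<lambda>w. scaleV (form v w) u - scaleV (form u w) v)"

end

text \<open>The module structure over the Clifford algebra is given by \<open>act\<close>, of which only the values
  on cosets matter. By \<open>act_const\<close> scalars of the Clifford algebra act as scalars.\<close>

locale clifford_module = quadratic_space scaleV form + W: vector_space scaleW
  for scaleV :: "'k::field \<Rightarrow> 'v::ab_group_add \<Rightarrow> 'v" and form :: "'v \<Rightarrow> 'v \<Rightarrow> 'k"
    and scaleW :: "'k \<Rightarrow> 'w::ab_group_add \<Rightarrow> 'w" +
  fixes act :: "('v, 'k) free_algebra set \<Rightarrow> 'w \<Rightarrow> 'w"
  assumes W_fin_dim: "fin_dim scaleW UNIV"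
    and W_nonzero: "\<exists>s :: 'w. s \<noteq> 0"
    and act_one: "act (cl 1) s = s"
    and act_mult: "act (cl (x * y)) s = act (cl x) (act (cl y) s)"
    and act_add: "act (cl (x + y)) s = act (cl x) s + act (cl y) s"
    and act_const: "act (cl (const c)) s = scaleW c s"
    and act_add_right: "act (cl x) (s + t) = act (cl x) s + act (cl x) t"
begin

definition cliff :: "'v \<Rightarrow> 'w \<Rightarrow> 'w" where
  "cliff v s = act (cl (gen v)) s"

text \<open>The graph of the spin representation: the span, in \<open>End V \<times> End W\<close>, of the pairs
  consisting of \<open>w \<mapsto> (v,w)u - (u,w)v\<close> and of the action of \<open>1/4(vu - uv)\<close>. Over a field of
  characteristic 0 it is the graph of a function on \<open>so\<close>.\<close>

inductive spin_graph :: "('v \<Rightarrow> 'v) \<Rightarrow> ('w \<Rightarrow> 'w) \<Rightarrow> bool" where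
  gen: "spin_graph (wedge v u) (act (cl (const (1 / 4) * (gen v * gen u - gen u * gen v))))"
| add: "spin_graph A S \<Longrightarrow> spin_graph B T
    \<Longrightarrow> spin_graph (\<lambda>v. A v + B v) (\<lambda>s. S s + T s)"
| scale: "spin_graph A S \<Longrightarrow> spin_graph (\<lambda>v. scaleV c (A v)) (\<lambda>s. scaleW c (S s))"

definition spin :: "('v \<Rightarrow> 'v) \<Rightarrow> 'w \<Rightarrow> 'w" where
  "spin A = (THE S. spin_graph A S)"

lemma cliff_clifford: "cliff v (cliff u s) + cliff u (cliff v s) = scaleW (- 2 * form v u) s"
proof -
  have "cl (gen v * gen u + gen u * gen v) = cl (const (- 2 * form v u))"
  proof (rule clifford_class_eqI)
    have "(const (- 2 * form v u) :: ('v, 'k) free_algebra) = - const (2 * form v u)"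
      by (simp only: const_def single_uminus[symmetric] minus_mult_left)
    then show "gen v * gen u + gen u * gen v - const (- 2 * form v u)
        \<in> clifford_ideal scaleV form"
      using clifford_ideal.clifford[of v u form scaleV] by (simp only: diff_minus_eq_add)
  qed
  then have "act (cl (gen v * gen u + gen u * gen v)) s = scaleW (- 2 * form v u) s"
    by (simp only: act_const)
  then show ?thesis
    by (simp only: act_add act_mult cliff_def)
qed

end

text \<open>In \<open>beta_clifford\<close> the scalar \<open>eps\<close> is \<open>-1\<close> for symmetric and \<open>1\<close> for skew-symmetric
  \<open>beta\<close>.\<close>

locale extended_translation_algebra = clifford_module scaleV form scaleW act
  for scaleV :: "'k::field \<Rightarrow> 'v::ab_group_add \<Rightarrow> 'v" and form :: "'v \<Rightarrow> 'v \<Rightarrow> 'k"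
    and scaleW :: "'k \<Rightarrow> 'w::ab_group_add \<Rightarrow> 'w"
    and act :: "('v, 'k) free_algebra set \<Rightarrow> 'w \<Rightarrow> 'w" +
  fixes beta :: "'w \<Rightarrow> 'w \<Rightarrow> 'k"
  assumes beta_add_left: "beta (s + s') t = beta s t + beta s' t"
    and beta_scale_left: "beta (scaleW c s) t = c * beta s t"
    and beta_add_right: "beta s (t + t') = beta s t + beta s t'"
    and beta_scale_right: "beta s (scaleW c t) = c * beta s t"
    and beta_nondegenerate: "(\<And>t. beta s t = 0) \<Longrightarrow> s = 0"
    and beta_so_invariant: "A \<in> so \<Longrightarrow> beta (spin A s) t + beta s (spin A t) = 0"
    and beta_clifford: "\<exists>eps.
      ((\<forall>s t. beta s t = beta t s) \<and> eps = -1 \<or> (\<forall>s t. beta s t = - beta t s) \<and> eps = 1) \<and>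
      (\<forall>v s t. beta (cliff v s) t = eps * beta s (cliff v t))"
begin

definition bracketW :: "'w \<Rightarrow> 'w \<Rightarrow> 'v" where
  "bracketW s t = (THE x. \<forall>v. form x v = beta (cliff v s) t)"

text \<open>The graded Lie algebra \<open>\<mm> = V + W\<close> on the product type.\<close>

definition m_scale :: "'k \<Rightarrow> 'v \<times> 'w \<Rightarrow> 'v \<times> 'w" where
  "m_scale c x = (scaleV c (fst x), scaleW c (snd x))"

definition m_br :: "'v \<times> 'w \<Rightarrow> 'v \<times> 'w \<Rightarrow> 'v \<times> 'w" where
  "m_br x y = (bracketW (snd x) (snd y), 0)"

definition m_gr :: "int \<Rightarrow> ('v \<times> 'w) set" where
  "m_gr p = (if p = -2 then UNIV \<times> {0} else if p = -1 then {0} \<times> UNIV else {0})"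

end


section \<open>Transitive prolongations\<close>

text \<open>The negatively graded part of \<open>\<gg>\<close> is identified with \<open>\<mm>\<close> by means of \<open>emb\<close>.\<close>

locale transitive_prolongation =
  extended_translation_algebra scaleV form scaleW act beta + graded_lie_algebra scale br gr
  for scaleV :: "'k::field \<Rightarrow> 'v::ab_group_add \<Rightarrow> 'v" and form :: "'v \<Rightarrow> 'v \<Rightarrow> 'k"
    and scaleW :: "'k \<Rightarrow> 'w::ab_group_add \<Rightarrow> 'w"
    and act :: "('v, 'k) free_algebra set \<Rightarrow> 'w \<Rightarrow> 'w"
    and beta :: "'w \<Rightarrow> 'w \<Rightarrow> 'k"
    and scale :: "'k \<Rightarrow> 'g::ab_group_add \<Rightarrow> 'g" and br :: "'g \<Rightarrow> 'g \<Rightarrow> 'g"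
    and gr :: "int \<Rightarrow> 'g set" +
  fixes emb :: "'v \<times> 'w \<Rightarrow> 'g"
  assumes gr_fin_dim: "fin_dim scale (gr p)"
    and emb_hom: "graded_lie_hom m_scale m_br m_gr scale br gr emb"
    and emb_inj: "inj emb"
    and emb_negative: "p < 0 \<Longrightarrow> emb ` m_gr p = gr p"
    and transitive: "p \<ge> 0 \<Longrightarrow> X \<in> gr p \<Longrightarrow> (\<And>Y. Y \<in> gr (-1) \<Longrightarrow> br X Y = 0) \<Longrightarrow> X = 0"
begin

definition is_so_embedding :: "(('v \<Rightarrow> 'v) \<Rightarrow> 'g) \<Rightarrow> bool" where
  "is_so_embedding phi \<longleftrightarrow> phi ` so \<subseteq> gr 0 \<and> inj_on phi so \<and>
     (\<forall>A\<in>so. \<forall>B\<in>so. phi (\<lambda>v. A v + B v) = phi A + phi B) \<and>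
     (\<forall>c. \<forall>A\<in>so. phi (\<lambda>v. scaleV c (A v)) = scale c (phi A)) \<and>
     (\<forall>A\<in>so. \<forall>B\<in>so. phi (\<lambda>v. A (B v) - B (A v)) = br (phi A) (phi B)) \<and>
     (\<forall>A\<in>so. \<forall>v. br (phi A) (emb (v, 0)) = emb (A v, 0)) \<and>
     (\<forall>A\<in>so. \<forall>s. br (phi A) (emb (0, s)) = emb (0, spin A s))"

definition is_grading_element :: "'g \<Rightarrow> bool" where
  "is_grading_element E \<longleftrightarrow> E \<in> gr 0 \<and>
     (\<forall>s. br E (emb (0, s)) = scale (-1) (emb (0, s))) \<and>
     (\<forall>v. br E (emb (v, 0)) = scale (-2) (emb (v, 0)))"

definition h0 :: "'g set" where
  "h0 = {D \<in> gr 0. \<forall>v. br D (emb (v, 0)) = 0}"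

end

text \<open>Maximality refers to all graded Lie algebras. Since a transitive prolongation has
  finite-dimensional homogeneous components, it has countable dimension and hence is isomorphic
  to one whose underlying space is a subspace of the space of finitely supported sequences; it
  therefore suffices to quantify over those. The injection need not respect the embeddings of
  \<open>\<mm>\<close>.\<close>

definition seq_scale :: "'k::field \<Rightarrow> (nat \<Rightarrow>\<^sub>0 'k) \<Rightarrow> (nat \<Rightarrow>\<^sub>0 'k)" where
  "seq_scale c x = Poly_Mapping.map ((*) c) x"

lemma lookup_seq_scale: "Poly_Mapping.lookup (seq_scale c x) n = c * Poly_Mapping.lookup x n"
  by (simp add: seq_scale_def Poly_Mapping.map.rep_eq when_def)

lemma vector_space_seq_scale: "vector_space (seq_scale :: 'k::field \<Rightarrow> _)"
  by unfold_locales
    (simp_all add: poly_mapping_eq_iff fun_eq_iff lookup_add lookup_seq_scale algebra_simps)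

definition maximal_transitive_prolongation ::
    "('k::field \<Rightarrow> 'v::ab_group_add \<Rightarrow> 'v) \<Rightarrow> ('v \<Rightarrow> 'v \<Rightarrow> 'k) \<Rightarrow> ('k \<Rightarrow> 'w::ab_group_add \<Rightarrow> 'w)
      \<Rightarrow> (('v, 'k) free_algebra set \<Rightarrow> 'w \<Rightarrow> 'w) \<Rightarrow> ('w \<Rightarrow> 'w \<Rightarrow> 'k)
      \<Rightarrow> ('k \<Rightarrow> 'g::ab_group_add \<Rightarrow> 'g) \<Rightarrow> ('g \<Rightarrow> 'g \<Rightarrow> 'g) \<Rightarrow> (int \<Rightarrow> 'g set)
      \<Rightarrow> ('v \<times> 'w \<Rightarrow> 'g) \<Rightarrow> bool" where
  "maximal_transitive_prolongation scaleV form scaleW act beta scale br gr emb \<longleftrightarrow>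
     transitive_prolongation scaleV form scaleW act beta scale br gr emb \<and>
     (\<forall>(br' :: (nat \<Rightarrow>\<^sub>0 'k) \<Rightarrow> (nat \<Rightarrow>\<^sub>0 'k) \<Rightarrow> (nat \<Rightarrow>\<^sub>0 'k)) gr' emb'.
        transitive_prolongation scaleV form scaleW act beta seq_scale br' gr' emb' \<longrightarrow>
        (\<exists>f. graded_lie_hom seq_scale br' gr' scale br gr f \<and>
             inj_on f (graded_space seq_scale gr')))"

end

theory Submission
  imports Defs "HOL-Library.Function_Algebras"
begin

text \<open>
  By transitivity an element of \<open>\<gg>\<^sub>0\<close> is determined by the derivation \<open>(A, S)\<close> of
  \<open>\<mm> = V + W\<close> by which it acts, and by maximality every derivation of degree 0 occurs
  (\<open>full_prolongation_if_maximal\<close>): the space \<open>\<mm> + Der(\<mm>)\<close>, with the evident bracket, is itself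
  a transitive prolongation and so embeds into \<open>\<gg>\<close>. Hence the theorem is a statement about pairs
  \<open>(A, S)\<close> with \<open>A [s,t] = [S s,t] + [s,S t]\<close>.

  The main point is that \<open>A\<close> lies in \<open>so(V) + K id\<close> (\<open>m_derivation_conformal\<close>). Let \<open>A*\<close> and \<open>S*\<close>
  be the adjoints with respect to the two forms. In terms of the Clifford action the derivation
  property reads \<open>A* v = v S + S* v\<close> in \<open>End W\<close>. Multiplying by \<open>u\<close> and taking traces gives
  \<open>- dim W (u, A* v) = 2 tr (u v S)\<close>, because both terms on the right have the same trace. The
  part of the right side that is symmetric in \<open>u\<close> and \<open>v\<close> is a multiple of \<open>(u, v) tr S\<close> by the
  Clifford relation, so \<open>A + A*\<close> is a scalar.

  Now \<open>so(V)\<close> acts on \<open>\<mm>\<close> by derivations \<open>(A, spin A)\<close>, and the grading element realises a nonzero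
  scalar on \<open>V\<close>. Subtracting suitable multiples of these from a derivation leaves one that vanishes
  on \<open>V\<close>, an element of \<open>\<hh>\<^sub>0\<close>. This gives the decomposition, which is unique because \<open>so(V)\<close>
  contains no nonzero scalars. The grading element is central and \<open>\<hh>\<^sub>0\<close> is the kernel of the
  action on \<open>V\<close>, so that \<open>K E\<close> and \<open>\<hh>\<^sub>0\<close> are ideals. For \<open>so(V)\<close> it remains to see that \<open>\<hh>\<^sub>0\<close>
  commutes with it (\<open>vertical_derivation_cliff\<close>): for \<open>A = 0\<close> the derivation property says
  \<open>v S = - S* v\<close>, which implies \<open>S v = - v S*\<close>, hence \<open>S\<close> commutes with all products \<open>v u\<close>, and
  these generate the spin representation.
\<close>

section \<open>Nondegenerate forms and dual bases\<close>

text \<open>Both the quadratic form on \<open>V\<close> and the form \<open>\<beta>\<close> on \<open>W\<close> are instances; the sign \<open>sg\<close>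
  tells symmetric from skew-symmetric forms.\<close>

locale nondegenerate_form = vector_space scale
  for scale :: "'k::field \<Rightarrow> 'a::ab_group_add \<Rightarrow> 'a" +
  fixes b :: "'a \<Rightarrow> 'a \<Rightarrow> 'k" and sg :: 'k
  assumes fin_dim_UNIV: "fin_dim scale UNIV"
    and add_left: "b (x + y) z = b x z + b y z"
    and scale_left: "b (scale c x) z = c * b x z"
    and swap: "b x y = sg * b y x"
    and nondegenerate: "(\<And>y. b x y = 0) \<Longrightarrow> x = 0"
begin

lemma add_right: "b x (y + z) = b x y + b x z"
  by (simp add: swap[of x] add_left ring_distribs)

lemma scale_right: "b x (scale c y) = c * b x y"
  by (simp add: swap[of x] scale_left)

lemma zero_left [simp]: "b 0 y = 0"
  using scale_left[of 0 0 y] by simp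

lemma zero_right [simp]: "b x 0 = 0"
  using scale_right[of x 0 0] by simp

lemma diff_left: "b (x - y) z = b x z - b y z"
  using add_left[of "x - y" y z] by simp

lemma diff_right: "b z (x - y) = b z x - b z y"
  using add_right[of z "x - y" y] by simp

lemma sum_left: "b (\<Sum>i\<in>I. f i) y = (\<Sum>i\<in>I. b (f i) y)"
  by (induction I rule: infinite_finite_induct) (simp_all add: add_left)

lemma sum_right: "b x (\<Sum>i\<in>I. f i) = (\<Sum>i\<in>I. b x (f i))"
  by (induction I rule: infinite_finite_induct) (simp_all add: add_right)

lemma eqI_left: "(\<And>y. b x y = b x' y) \<Longrightarrow> x = x'"
  using nondegenerate[of "x - x'"] by (simp add: diff_left)

lemma eqI_right:
  assumes "\<And>y. b y x = b y x'"
  shows "x = x'"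
  using assms by (intro eqI_left) (metis swap)

lemma ex_basis:
  obtains B where "finite B" "independent B" "span B = UNIV"
proof -
  obtain S where S: "finite S" "span S = UNIV"
    using fin_dim_UNIV by (auto simp: fin_dim_def)
  obtain B where B: "independent B" "UNIV \<subseteq> span B"
    using maximal_independent_subset[of UNIV] by auto
  then have "finite B"
    using independent_span_bound[OF S(1) B(1)] S(2) by auto
  with B show thesis
    using that by blast
qed

lemma linear_inj_imp_surj:
  assumes "Vector_Spaces.linear scale scale f" "inj f"
  shows "surj f"
proof -
  obtain B where "finite B" "independent B" "span B = UNIV"
    by (rule ex_basis)
  then interpret finite_dimensional_vector_space scale B
    by unfold_locales
  show ?thesis
    by (rule linear_inj_imp_surj[OF assms])
qed

text \<open>Pairing with the vectors of a basis is an injective map from the space to its coordinate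
  space, which has the same dimension.\<close>

lemma dual_vector_exists:
  assumes g_add: "\<And>x y. g (x + y) = g x + g y"
    and g_scale: "\<And>c x. g (scale c x) = c * g x"
  shows "\<exists>y. \<forall>x. b x y = g x"
proof -
  obtain B where B: "finite B" "independent B" "span B = UNIV"
    by (rule ex_basis)
  define \<Phi> where "\<Phi> y = (\<Sum>c\<in>B. scale (b c y) c)" for y
  have lin: "Vector_Spaces.linear scale scale \<Phi>"
    unfolding Vector_Spaces.linear_iff \<Phi>_def
    by (simp add: vector_space_axioms add_right scale_right scale_left_distrib sum.distrib
        scale_sum_right)
  have agree: "h x = h' x" if "\<And>c. c \<in> B \<Longrightarrow> h c = (h' c :: 'k)"
      and "Vector_Spaces.linear scale (*) h" "Vector_Spaces.linear scale (*) h'" for h h' x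
  proof -
    interpret P: vector_space_pair scale "(*) :: 'k \<Rightarrow> 'k \<Rightarrow> 'k"
      by unfold_locales (simp_all add: algebra_simps)
    show ?thesis
      using P.linear_eq_on[OF that(2,3) _ that(1), of x B] B(3) by auto
  qed
  have field_space: "vector_space ((*) :: 'k \<Rightarrow> 'k \<Rightarrow> 'k)"
    by unfold_locales (simp_all add: algebra_simps)
  have lin_b: "Vector_Spaces.linear scale (*) (\<lambda>x. b x y)" for y
    by (simp add: Vector_Spaces.linear_iff vector_space_axioms field_space add_left scale_left)
  have lin_g: "Vector_Spaces.linear scale (*) g"
    by (simp add: Vector_Spaces.linear_iff vector_space_axioms field_space g_add g_scale)
  have unique: "f c = h c" if "(\<Sum>c\<in>B. scale (f c) c) = (\<Sum>c\<in>B. scale (h c) c)" "c \<in> B"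
    for f h c
  proof -
    have "(\<Sum>c\<in>B. scale (f c - h c) c) = 0"
      using that(1) by (simp add: scale_left_diff_distrib sum_subtractf)
    then have "f c - h c = 0"
      by (rule independentD[OF B(2,1) subset_refl _ that(2)])
    then show ?thesis by simp
  qed
  have "inj \<Phi>"
  proof (rule injI)
    fix y y' assume "\<Phi> y = \<Phi> y'"
    then have "b c y = b c y'" if "c \<in> B" for c
      using unique[of "\<lambda>c. b c y" "\<lambda>c. b c y'"] that by (simp add: \<Phi>_def)
    then have "b x y = b x y'" for x
      by (rule agree[OF _ lin_b lin_b])
    then show "y = y'"
      by (rule eqI_right)
  qed
  then have "surj \<Phi>"
    by (rule linear_inj_imp_surj[OF lin])
  then obtain y where "\<Phi> y = (\<Sum>c\<in>B. scale (g c) c)"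
    by (metis surjD)
  then have "b c y = g c" if "c \<in> B" for c
    using unique[of "\<lambda>c. b c y" g] that by (simp add: \<Phi>_def)
  then have "b x y = g x" for x
    by (rule agree[OF _ lin_b lin_g])
  then show ?thesis by blast
qed

end

text \<open>In the intended instances \<open>B\<close> is a basis and \<open>d c\<close> reads off the coordinate at \<open>c\<close>, so that
  \<open>\<Sum> c \<otimes> d c\<close> is the inverse of the form. This expresses traces by the form without a choice of
  an ordered basis.\<close>

locale dual_bases = nondegenerate_form +
  fixes B :: "'b set" and d :: "'b \<Rightarrow> 'b"
  assumes finite_basis: "finite B"
    and expand: "(\<Sum>c\<in>B. scale (b x (d c)) c) = x"
    and dual_self: "c \<in> B \<Longrightarrow> b c (d c) = 1"
begin

text \<open>The tensor \<open>\<Sum> c \<otimes> d c\<close> is inverse to the form, hence has the same symmetry.\<close>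

lemma expand_dual: "(\<Sum>c\<in>B. scale (b c x) (d c)) = x"
proof (rule eqI_right)
  fix y
  have "b y (\<Sum>c\<in>B. scale (b c x) (d c)) = b (\<Sum>c\<in>B. scale (b y (d c)) c) x"
    by (simp add: sum_right scale_right sum_left scale_left mult.commute)
  then show "b y (\<Sum>c\<in>B. scale (b c x) (d c)) = b y x"
    by (simp add: expand)
qed

lemma tensor_swap:
  assumes F_add: "\<And>x y z. F (x + y) z = F x z + F y z"
    and F_scale: "\<And>c x z. F (scale c x) z = c * F x z"
    and F_add': "\<And>x y z. F z (x + y) = F z x + F z y"
    and F_scale': "\<And>c x z. F z (scale c x) = c * F z x"
  shows "(\<Sum>c\<in>B. F c (d c)) = sg * (\<Sum>c\<in>B. F (d c) c)"
proof -
  have zero: "F 0 z = 0" "F z 0 = 0" for z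
    using F_scale[of 0 0 z] F_scale'[of z 0 0] by simp_all
  have sum1: "F (sum h B) z = (\<Sum>i\<in>B. F (h i) z)" for h z
    using finite_basis by (induction B) (simp_all add: zero F_add)
  have sum2: "F z (sum h B) = (\<Sum>i\<in>B. F z (h i))" for h z
    using finite_basis by (induction B) (simp_all add: zero F_add')
  have "(\<Sum>c\<in>B. F c (d c)) = (\<Sum>c\<in>B. F c (\<Sum>e\<in>B. scale (b (d c) (d e)) e))"
    by (simp add: expand)
  also have "\<dots> = (\<Sum>c\<in>B. \<Sum>e\<in>B. b (d c) (d e) * F c e)"
    by (simp add: sum2 F_scale')
  also have "\<dots> = (\<Sum>e\<in>B. \<Sum>c\<in>B. b (d c) (d e) * F c e)"
    by (rule sum.swap)
  also have "\<dots> = (\<Sum>e\<in>B. \<Sum>c\<in>B. sg * (b (d e) (d c) * F c e))"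
    by (intro sum.cong refl) (subst swap, simp add: mult_ac)
  also have "\<dots> = sg * (\<Sum>e\<in>B. F (\<Sum>c\<in>B. scale (b (d e) (d c)) c) e)"
    by (simp add: sum1 F_scale sum_distrib_left)
  finally show ?thesis
    by (simp add: expand)
qed

definition tr :: "('b \<Rightarrow> 'b) \<Rightarrow> 'a" where
  "tr X = (\<Sum>c\<in>B. b (X c) (d c))"

lemma tr_add: "tr (\<lambda>x. X x + Y x) = tr X + tr Y"
  by (simp add: tr_def add_left sum.distrib)

lemma tr_scale: "tr (\<lambda>x. scale a (X x)) = a * tr X"
  by (simp add: tr_def scale_left sum_distrib_left)

lemma tr_id: "tr (\<lambda>x. x) = of_nat (card B)"
  by (simp add: tr_def dual_self)

lemma tr_commute:
  assumes "Vector_Spaces.linear scale scale X" "Vector_Spaces.linear scale scale Y"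
  shows "tr (\<lambda>x. X (Y x)) = tr (\<lambda>x. Y (X x))"
proof -
  have *: "tr (\<lambda>x. X (Y x)) = (\<Sum>c\<in>B. \<Sum>e\<in>B. b (Y c) (d e) * b (X e) (d c))"
    if X: "Vector_Spaces.linear scale scale X" for X Y
  proof -
    interpret X: Vector_Spaces.linear scale scale X by (rule X)
    have "b (X (Y c)) (d c) = b (X (\<Sum>e\<in>B. scale (b (Y c) (d e)) e)) (d c)" for c
      by (simp add: expand)
    then show ?thesis
      by (simp add: tr_def X.sum X.scale sum_left scale_left)
  qed
  show ?thesis
    unfolding *[OF assms(1)] *[OF assms(2)]
    by (subst sum.swap) (simp add: mult.commute)
qed

end

lemma (in nondegenerate_form) ex_dual_bases: "\<exists>B d. dual_bases scale b sg B d"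
proof -
  obtain B where B: "finite B" "independent B" "span B = UNIV"
    by (rule ex_basis)
  have "\<exists>y. \<forall>x. b x y = representation B x c" for c
    by (rule dual_vector_exists)
      (simp_all add: representation_add representation_scale B)
  then obtain d where d: "b x (d c) = representation B x c" for c x
    by metis
  show ?thesis
  proof (intro exI)
    show "dual_bases scale b sg B d"
    proof unfold_locales
      show "(\<Sum>c\<in>B. scale (b x (d c)) c) = x" for x
        using sum_representation_eq[OF B(2) _ B(1), of x] B(3) by (simp add: d)
      show "b c (d c) = 1" if "c \<in> B" for c
        using representation_basis[OF B(2) that] by (simp add: d)
    qed (rule B(1))
  qed
qed


section \<open>The spin representation\<close>

sublocale quadratic_space \<subseteq> VF: nondegenerate_form scaleV form 1
proof unfold_locales
  show "form v u = 1 * form u v" for v u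
    by (simp add: form_sym)
qed (use V_fin_dim form_nondegenerate in \<open>simp_all add: form_add form_scale\<close>)

lemma (in quadratic_space) soI:
  assumes "\<And>v u. A (v + u) = A v + A u" "\<And>c v. A (scaleV c v) = scaleV c (A v)"
    and "\<And>v u. form (A v) u + form v (A u) = 0"
  shows "A \<in> so"
  using assms by (simp add: so_def Vector_Spaces.linear_iff V.vector_space_axioms)

lemma (in quadratic_space) soD:
  assumes "A \<in> so"
  shows "A (v + u) = A v + A u" "A (scaleV c v) = scaleV c (A v)"
    and "form (A v) u = - form v (A u)"
  using assms by (auto simp: so_def Vector_Spaces.linear_iff eq_neg_iff_add_eq_0)

lemma (in quadratic_space) so_commutator:
  assumes "A \<in> so" "B \<in> so"
  shows "(\<lambda>v. A (B v) - B (A v)) \<in> so"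
  by (rule soI) (simp_all add: soD[OF assms(1)] soD[OF assms(2)] V.scale_right_diff_distrib
      VF.diff_left VF.diff_right)

context clifford_module
begin

lemma cliff_add_left: "cliff (v + u) s = cliff v s + cliff u s"
proof -
  have "cl (gen (v + u)) = cl (gen v + gen u)"
    using clifford_ideal.additive[of v u scaleV form]
    by (intro clifford_class_eqI) (simp add: diff_diff_eq)
  then show ?thesis
    by (simp add: cliff_def act_add)
qed

lemma cliff_scale_left: "cliff (scaleV c v) s = scaleW c (cliff v s)"
proof -
  have "cl (gen (scaleV c v)) = cl (const c * gen v)"
    by (intro clifford_class_eqI clifford_ideal.homogeneous)
  then show ?thesis
    by (simp add: cliff_def act_mult act_const)
qed

lemma cliff_add_right: "cliff v (s + t) = cliff v s + cliff v t"
  by (simp add: cliff_def act_add_right)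

lemma cliff_scale_right: "cliff v (scaleW c s) = scaleW c (cliff v s)"
proof -
  have "gen v * const c = (const c * gen v :: ('v, 'k) free_algebra)"
    by (simp add: gen_def const_def mult_single)
  then show ?thesis
    unfolding cliff_def act_const[symmetric] act_mult[symmetric] by simp
qed

lemma linear_cliff: "Vector_Spaces.linear scaleW scaleW (cliff v)"
  by (simp add: Vector_Spaces.linear_iff W.vector_space_axioms cliff_add_right cliff_scale_right)

lemma cliff_diff_left: "cliff (v - u) s = cliff v s - cliff u s"
  using cliff_add_left[of "v - u" u s] by simp

lemma cliff_diff_right: "cliff v (s - t) = cliff v s - cliff v t"
  using cliff_add_right[of v "s - t" t] by simp

lemma cliff_minus_right: "cliff v (- s) = - cliff v s"
  using cliff_diff_right[of v 0 s] cliff_diff_right[of v 0 0] by simp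

lemma cliff_zero_left [simp]: "cliff 0 s = 0"
  using cliff_diff_left[of 0 0 s] by simp

lemma cliff_zero_right [simp]: "cliff v 0 = 0"
  using cliff_diff_right[of v 0 0] by simp

lemma cliff_sum_left: "cliff (\<Sum>i\<in>I. f i) s = (\<Sum>i\<in>I. cliff (f i) s)"
  by (induction I rule: infinite_finite_induct) (simp_all add: cliff_add_left)

lemma cliff_swap: "cliff v (cliff u s) = scaleW (- 2 * form v u) s - cliff u (cliff v s)"
  using cliff_clifford[of v u s] by (simp add: eq_diff_eq)

lemma act_spin_generator:
  "act (cl (const (1 / 4) * (gen v * gen u - gen u * gen v))) s =
    scaleW (1 / 4) (cliff v (cliff u s) - cliff u (cliff v s))"
proof -
  have "const (-1) = (-1 :: ('v, 'k) free_algebra)"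
    by (simp add: const_def single_uminus)
  then have "gen v * gen u - gen u * gen v =
      (gen v * gen u + const (-1) * (gen u * gen v) :: ('v, 'k) free_algebra)"
    by simp
  then show ?thesis
    by (simp only: act_mult act_add act_const cliff_def) simp
qed

lemma spin_graph_wedge:
  "spin_graph (wedge v u) (\<lambda>s. scaleW (1 / 4) (cliff v (cliff u s) - cliff u (cliff v s)))"
  using spin_graph.gen[of v u] by (simp add: act_spin_generator[abs_def])

lemma spin_graph_in_so: "spin_graph A S \<Longrightarrow> A \<in> so"
proof (induction rule: spin_graph.induct)
  case (gen v u)
  show ?case
    by (rule soI)
      (simp_all add: wedge_def VF.add_right VF.scale_right VF.scale_left VF.diff_left
        VF.diff_right V.scale_left_distrib V.scale_right_diff_distrib mult_ac
        VF.add_left form_sym[of v] form_sym[of u])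
next
  case (add A S B T)
  show ?case
    by (rule soI)
      (simp_all add: soD[OF add.IH(1)] soD[OF add.IH(2)] VF.add_left VF.add_right
        V.scale_right_distrib)
next
  case (scale A S c)
  show ?case
    by (rule soI) (simp_all add: soD[OF scale.IH] VF.scale_left VF.scale_right
        V.scale_right_distrib mult.commute)
qed

lemma spin_graph_linear: "spin_graph A S \<Longrightarrow> Vector_Spaces.linear scaleW scaleW S"
proof (induction rule: spin_graph.induct)
  case (gen v u)
  show ?case
    unfolding Vector_Spaces.linear_iff act_spin_generator
    by (simp add: W.vector_space_axioms cliff_add_right cliff_scale_right
        W.scale_right_distrib W.scale_right_diff_distrib)
qed (simp_all add: Vector_Spaces.linear_iff W.scale_right_distrib mult.commute)

text \<open>The reason why the spin representation is a well-defined function on \<open>so\<close>: in terms of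
  dual bases \<open>e\<close>, \<open>e'\<close> of \<open>V\<close>, the endomorphism paired with \<open>A\<close> is \<open>1/4 \<Sum> e (A e')\<close>.\<close>

lemma spin_graph_formula:
  assumes "dual_bases scaleV form 1 B d" and "spin_graph A S"
  shows "S s = scaleW (1 / 4) (\<Sum>c\<in>B. cliff c (cliff (A (d c)) s))"
proof -
  interpret D: dual_bases scaleV form 1 B d by (rule assms(1))
  show ?thesis
    using assms(2)
  proof (induction)
    case (gen v u)
    have *: "(\<Sum>c\<in>B. scaleW (form v (d c)) (cliff c t)) = cliff v t" for v t
      by (simp flip: cliff_scale_left cliff_sum_left add: D.expand)
    show ?case
      by (simp add: act_spin_generator wedge_def cliff_diff_left cliff_diff_right
          cliff_scale_left cliff_scale_right sum_subtractf *)
  next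
    case (add A S B' T)
    then show ?case
      by (simp add: cliff_add_left cliff_add_right sum.distrib W.scale_right_distrib)
  next
    case (scale A S k)
    then show ?case
      by (simp add: cliff_scale_left cliff_scale_right flip: W.scale_sum_right)
  qed
qed

lemma spin_graph_unique:
  assumes "spin_graph A S" "spin_graph A T"
  shows "S = T"
proof -
  obtain B d where "dual_bases scaleV form 1 B d"
    using VF.ex_dual_bases by blast
  from spin_graph_formula[OF this assms(1)] spin_graph_formula[OF this assms(2)]
  show ?thesis by (simp add: fun_eq_iff)
qed

lemma spin_eqI: "spin_graph A S \<Longrightarrow> spin A = S"
  unfolding spin_def using spin_graph_unique by blast

lemma spin_graph_sum:
  assumes "finite I" "\<And>i. i \<in> I \<Longrightarrow> spin_graph (A i) (S i)"
  shows "spin_graph (\<lambda>v. \<Sum>i\<in>I. A i v) (\<lambda>s. \<Sum>i\<in>I. S i s)"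
  using assms
proof (induction I)
  case empty
  show ?case
    using spin_graph.scale[OF spin_graph_wedge[of 0 0], of 0] by simp
next
  case (insert i I)
  then show ?case
    using spin_graph.add[of "A i" "S i"] by simp
qed

end

locale clifford_module_char_not_two = clifford_module scaleV form scaleW act
  for scaleV :: "'k::field \<Rightarrow> 'v::ab_group_add \<Rightarrow> 'v" and form :: "'v \<Rightarrow> 'v \<Rightarrow> 'k"
    and scaleW :: "'k \<Rightarrow> 'w::ab_group_add \<Rightarrow> 'w"
    and act :: "('v, 'k) free_algebra set \<Rightarrow> 'w \<Rightarrow> 'w" +
  assumes two_nonzero: "(2 :: 'k) \<noteq> 0"
begin

lemma four_nonzero: "(4 :: 'k) \<noteq> 0"
proof -
  have "(4 :: 'k) = 2 * 2" by simp
  then show ?thesis using two_nonzero by (metis mult_eq_0_iff)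
qed

text \<open>A skew endomorphism \<open>A\<close> is \<open>1/2 \<Sum> e \<and> A e'\<close>.\<close>

lemma spin_graph_spin:
  assumes A: "A \<in> so"
  shows "spin_graph A (spin A)"
proof -
  obtain B d where "dual_bases scaleV form 1 B d"
    using VF.ex_dual_bases by blast
  then interpret D: dual_bases scaleV form 1 B d .
  interpret A: Vector_Spaces.linear scaleV scaleV A
    using A by (simp add: so_def)
  have "spin_graph (\<lambda>v. scaleV (1 / 2) (\<Sum>c\<in>B. wedge c (A (d c)) v))
      (\<lambda>s. scaleW (1 / 2) (\<Sum>c\<in>B. scaleW (1 / 4)
        (cliff c (cliff (A (d c)) s) - cliff (A (d c)) (cliff c s))))"
    by (intro spin_graph.scale spin_graph_sum spin_graph_wedge D.finite_basis)
  moreover have "(\<lambda>v. scaleV (1 / 2) (\<Sum>c\<in>B. wedge c (A (d c)) v)) = A"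
  proof
    fix v
    have "wedge c (A (d c)) v = A (scaleV (form c v) (d c)) + scaleV (form (A v) (d c)) c" for c
      by (simp add: wedge_def A.scale soD(3)[OF A] form_sym[of "d c"])
    then have "(\<Sum>c\<in>B. wedge c (A (d c)) v) =
        A (\<Sum>c\<in>B. scaleV (form c v) (d c)) + (\<Sum>c\<in>B. scaleV (form (A v) (d c)) c)"
      by (simp add: sum.distrib A.sum)
    also have "\<dots> = scaleV 2 (A v)"
      using V.scale_left_distrib[of 1 1 "A v"] by (simp add: D.expand D.expand_dual)
    finally show "scaleV (1 / 2) (\<Sum>c\<in>B. wedge c (A (d c)) v) = A v"
      using two_nonzero by simp
  qed
  ultimately have "\<exists>S. spin_graph A S"
    by metis
  then show ?thesis
    using spin_eqI by blast
qed

text \<open>Clifford multiplication is equivariant: moving \<open>w\<close> to the left through \<open>v u\<close> by two uses of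
  the Clifford relation produces \<open>2 (v,w) u - 2 (u,w) v\<close>.\<close>

lemma spin_graph_cliff:
  assumes "spin_graph A S"
  shows "S (cliff w s) = cliff w (S s) + cliff (A w) s"
  using assms
proof (induction)
  case (gen v u)
  have *: "cliff v (cliff u (cliff w s)) = cliff w (cliff v (cliff u s))
      + scaleW (2 * form v w) (cliff u s) - scaleW (2 * form u w) (cliff v s)" for v u
    by (subst cliff_swap[of u w], subst cliff_diff_right, subst cliff_swap[of v w])
      (simp add: cliff_scale_right cliff_minus_right)
  have "cliff v (cliff u (cliff w s)) - cliff u (cliff v (cliff w s)) =
      cliff w (cliff v (cliff u s) - cliff u (cliff v s)) + scaleW 4 (cliff (wedge v u w) s)"
    using W.scale_left_distrib[of 2 2]
    by (simp add: * wedge_def cliff_diff_left cliff_diff_right cliff_scale_left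
        W.scale_right_diff_distrib flip: W.scale_scale)
  then show ?case
    using four_nonzero by (simp add: act_spin_generator W.scale_right_distrib cliff_scale_right)
next
  case (add A S B T)
  then show ?case
    by (simp add: cliff_add_left cliff_add_right)
next
  case (scale A S c)
  then show ?case
    by (simp add: cliff_scale_left cliff_scale_right W.scale_right_distrib)
qed

text \<open>The spin representation is a homomorphism, because both sides of
  \<open>[A, v \<and> u] = (A v) \<and> u + v \<and> (A u)\<close> have the same counterpart in \<open>End W\<close> by equivariance.\<close>

lemma spin_graph_commutator:
  assumes "spin_graph B T" and AS: "spin_graph A S"
  shows "spin_graph (\<lambda>v. A (B v) - B (A v)) (\<lambda>s. S (T s) - T (S s))"
proof -
  note A = soD[OF spin_graph_in_so[OF AS]]
  interpret A: Vector_Spaces.linear scaleV scaleV A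
    using spin_graph_in_so[OF AS] by (simp add: so_def)
  interpret S: Vector_Spaces.linear scaleW scaleW S
    by (rule spin_graph_linear[OF AS])
  show ?thesis
    using assms(1)
  proof (induction)
    case (gen v u)
    have "A (wedge v u w) - wedge v u (A w) = wedge (A v) u w + wedge v (A u) w" for w
      by (simp add: wedge_def A.diff A.scale A(3))
    moreover have "S (scaleW (1 / 4) (cliff v (cliff u s) - cliff u (cliff v s)))
          - scaleW (1 / 4) (cliff v (cliff u (S s)) - cliff u (cliff v (S s)))
        = scaleW (1 / 4) (cliff (A v) (cliff u s) - cliff u (cliff (A v) s))
          + scaleW (1 / 4) (cliff v (cliff (A u) s) - cliff (A u) (cliff v s))" for s
      by (simp add: S.diff S.scale spin_graph_cliff[OF AS] cliff_add_right
          flip: W.scale_right_distrib W.scale_right_diff_distrib)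
    ultimately show ?case
      using spin_graph.add[OF spin_graph_wedge[of "A v" u] spin_graph_wedge[of v "A u"]]
      by (simp add: act_spin_generator)
  next
    case (add B T B' T')
    then show ?case
      using spin_graph.add[OF add.IH] by (simp add: A.add S.add algebra_simps)
  next
    case (scale B T c)
    then show ?case
      using spin_graph.scale[OF scale.IH, of c]
      by (simp add: A.scale S.scale V.scale_right_diff_distrib W.scale_right_diff_distrib)
  qed
qed

end


section \<open>Derivations of degree zero\<close>

text \<open>Characteristic 0 is what the field contributes: the spin representation needs \<open>1/4\<close>, and the
  trace argument divides by \<open>dim W\<close>.\<close>

locale char_zero_translation_algebra = extended_translation_algebra scaleV form scaleW act beta
  for scaleV :: "'k::field \<Rightarrow> 'v::ab_group_add \<Rightarrow> 'v" and form :: "'v \<Rightarrow> 'v \<Rightarrow> 'k"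
    and scaleW :: "'k \<Rightarrow> 'w::ab_group_add \<Rightarrow> 'w"
    and act :: "('v, 'k) free_algebra set \<Rightarrow> 'w \<Rightarrow> 'w"
    and beta :: "'w \<Rightarrow> 'w \<Rightarrow> 'k" +
  assumes char_zero: "of_nat n = (0 :: 'k) \<Longrightarrow> n = 0"

sublocale char_zero_translation_algebra \<subseteq> clifford_module_char_not_two
  by unfold_locales (use char_zero[of 2] in auto)

context extended_translation_algebra
begin

text \<open>The sign that couples the symmetry of \<open>\<beta>\<close> to its behaviour under Clifford multiplication;
  the form \<open>\<beta>\<close> is \<open>(-eps)\<close>-symmetric.\<close>

definition eps :: 'k where
  "eps = (SOME e. ((\<forall>s t. beta s t = beta t s) \<and> e = -1 \<or>
      (\<forall>s t. beta s t = - beta t s) \<and> e = 1) \<and>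
    (\<forall>v s t. beta (cliff v s) t = e * beta s (cliff v t)))"

lemma eps_cases: "(\<forall>s t. beta s t = beta t s) \<and> eps = -1 \<or> (\<forall>s t. beta s t = - beta t s) \<and> eps = 1"
    and beta_cliff_left: "beta (cliff v s) t = eps * beta s (cliff v t)"
proof -
  note spec = someI_ex[OF beta_clifford, folded eps_def]
  show "(\<forall>s t. beta s t = beta t s) \<and> eps = -1 \<or> (\<forall>s t. beta s t = - beta t s) \<and> eps = 1"
    by (rule conjunct1[OF spec])
  show "beta (cliff v s) t = eps * beta s (cliff v t)"
    by (rule conjunct2[OF spec, rule_format])
qed

lemma eps_square: "eps * eps = 1"
proof -
  have "eps = -1 \<or> eps = 1"
    using eps_cases by blast
  then show ?thesis by auto
qed

lemma beta_swap: "beta s t = - eps * beta t s"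
proof -
  have "beta s t = beta t s \<and> eps = -1 \<or> beta s t = - beta t s \<and> eps = 1"
    using eps_cases by blast
  then show ?thesis by (elim disjE conjE) (simp_all only: minus_minus mult_1 mult_minus_left)
qed

lemma beta_cliff_right: "beta s (cliff v t) = eps * beta (cliff v s) t"
  by (simp add: beta_cliff_left eps_square flip: mult.assoc)

sublocale WF: nondegenerate_form scaleW beta "- eps"
proof unfold_locales
  show "beta s t = - eps * beta t s" for s t
    by (rule beta_swap)
qed (use W_fin_dim beta_nondegenerate in
  \<open>simp_all add: beta_add_left beta_scale_left\<close>)

lemma form_bracketW: "form (bracketW s t) v = beta (cliff v s) t"
proof -
  obtain y where y: "form x y = beta (cliff x s) t" for x
    using VF.dual_vector_exists[of "\<lambda>x. beta (cliff x s) t"]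
    by (auto simp: cliff_add_left cliff_scale_left beta_add_left beta_scale_left)
  have "bracketW s t = y"
    unfolding bracketW_def
  proof (rule the_equality)
    show "\<forall>v. form y v = beta (cliff v s) t"
      using y form_sym[of y] by simp
    show "x = y" if "\<forall>v. form x v = beta (cliff v s) t" for x
      by (rule VF.eqI_left) (simp add: that y form_sym[of y])
  qed
  then show ?thesis
    using y form_sym[of y] by simp
qed

lemma bracketW_bilinear:
  "bracketW (s + s') t = bracketW s t + bracketW s' t"
  "bracketW s (t + t') = bracketW s t + bracketW s t'"
  "bracketW (scaleW c s) t = scaleV c (bracketW s t)"
  "bracketW s (scaleW c t) = scaleV c (bracketW s t)"
  by (rule VF.eqI_left; simp add: form_bracketW cliff_add_right cliff_scale_right WF.add_left
      WF.add_right WF.scale_left WF.scale_right VF.add_left VF.scale_left)+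

lemma bracketW_zero [simp]: "bracketW 0 t = 0" "bracketW s 0 = 0"
  using bracketW_bilinear(3)[of 0 0 t] bracketW_bilinear(4)[of s 0 0] by simp_all

lemma bracketW_diff:
  "bracketW (s - s') t = bracketW s t - bracketW s' t"
  "bracketW s (t - t') = bracketW s t - bracketW s t'"
  by (simp_all add: eq_diff_eq flip: bracketW_bilinear)

lemma bracketW_swap: "bracketW s t = - bracketW t s"
proof -
  have "bracketW s t + bracketW t s = 0"
  proof (rule VF.nondegenerate)
    fix v
    have "beta (cliff v s) t = - (eps * eps) * beta (cliff v t) s"
      using beta_swap[of s "cliff v t"] by (simp add: beta_cliff_left[of v s])
    then show "form (bracketW s t + bracketW t s) v = 0"
      by (simp add: VF.add_left form_bracketW eps_square)
  qed
  then show ?thesis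
    by (simp add: eq_neg_iff_add_eq_0)
qed

definition m_derivation :: "('v \<Rightarrow> 'v) \<Rightarrow> ('w \<Rightarrow> 'w) \<Rightarrow> bool" where
  "m_derivation A S \<longleftrightarrow>
     Vector_Spaces.linear scaleV scaleV A \<and> Vector_Spaces.linear scaleW scaleW S \<and>
     (\<forall>s t. A (bracketW s t) = bracketW (S s) t + bracketW s (S t))"

lemma m_derivation_bracketW:
  "m_derivation A S \<Longrightarrow> A (bracketW s t) = bracketW (S s) t + bracketW s (S t)"
  by (simp add: m_derivation_def)

lemma m_derivation_at_0:
  assumes "m_derivation A S"
  shows "A 0 = 0" "S 0 = 0"
proof -
  interpret A: Vector_Spaces.linear scaleV scaleV A using assms by (simp add: m_derivation_def)
  interpret S: Vector_Spaces.linear scaleW scaleW S using assms by (simp add: m_derivation_def)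
  show "A 0 = 0" "S 0 = 0"
    by (rule A.zero, rule S.zero)
qed

lemma m_derivation_commutator:
  assumes "m_derivation A S" "m_derivation B T"
  shows "m_derivation (\<lambda>v. A (B v) - B (A v)) (\<lambda>s. S (T s) - T (S s))"
proof -
  interpret A: Vector_Spaces.linear scaleV scaleV A using assms by (simp add: m_derivation_def)
  interpret B: Vector_Spaces.linear scaleV scaleV B using assms by (simp add: m_derivation_def)
  interpret S: Vector_Spaces.linear scaleW scaleW S using assms by (simp add: m_derivation_def)
  interpret T: Vector_Spaces.linear scaleW scaleW T using assms by (simp add: m_derivation_def)
  show ?thesis
    unfolding m_derivation_def Vector_Spaces.linear_iff
    by (simp add: V.vector_space_axioms W.vector_space_axioms A.add B.add S.add T.add
        A.scale B.scale S.scale T.scale V.scale_right_diff_distrib W.scale_right_diff_distrib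
        assms[THEN m_derivation_bracketW] bracketW_diff)
qed

lemma m_derivation_add:
  assumes "m_derivation A S" "m_derivation B T"
  shows "m_derivation (\<lambda>v. A v + B v) (\<lambda>s. S s + T s)"
  using assms unfolding m_derivation_def Vector_Spaces.linear_iff
  by (simp add: bracketW_bilinear V.scale_right_distrib W.scale_right_distrib)

lemma m_derivation_scale:
  assumes "m_derivation A S"
  shows "m_derivation (\<lambda>v. scaleV c (A v)) (\<lambda>s. scaleW c (S s))"
  using assms unfolding m_derivation_def Vector_Spaces.linear_iff
  by (simp add: bracketW_bilinear V.scale_right_distrib W.scale_right_distrib mult.commute)

lemma m_derivation_grading: "m_derivation (scaleV (-2)) (scaleW (-1))"
proof -
  have "scaleV (-2) x = scaleV (-1) x + scaleV (-1) x" for x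
    by (simp flip: V.scale_left_distrib del: V.scale_minus_left)
  then show ?thesis
    unfolding m_derivation_def
    by (simp add: V.linear_scale_self W.linear_scale_self bracketW_bilinear
        del: V.scale_minus_left W.scale_minus_left)
qed

end

context char_zero_translation_algebra
begin

lemma bracketW_self: "bracketW s s = 0"
proof -
  have "scaleV 2 (bracketW s s) = 0"
    using V.scale_left_distrib[of 1 1 "bracketW s s"] bracketW_swap[of s s]
    by (metis V.scale_one add.right_inverse one_add_one)
  then show ?thesis
    using two_nonzero by simp
qed

text \<open>Invariance of \<open>\<beta>\<close>, applied to \<open>v s\<close> and \<open>t\<close>, and the equivariance of Clifford
  multiplication make \<open>[s,t]\<close> an equivariant function of \<open>s\<close> and \<open>t\<close>.\<close>

lemma m_derivation_spin:
  assumes "A \<in> so"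
  shows "m_derivation A (spin A)"
proof -
  note S = spin_graph_spin[OF assms]
  have "A (bracketW s t) = bracketW (spin A s) t + bracketW s (spin A t)" for s t
  proof (rule VF.eqI_left)
    fix v
    have "beta (cliff v (spin A s)) t = beta (spin A (cliff v s)) t - beta (cliff (A v) s) t"
      by (simp add: spin_graph_cliff[OF S] WF.add_left)
    then show "form (A (bracketW s t)) v =
        form (bracketW (spin A s) t + bracketW s (spin A t)) v"
      using beta_so_invariant[OF assms, of "cliff v s" t]
      by (simp add: soD(3)[OF assms] VF.add_left form_bracketW)
  qed
  then show ?thesis
    using assms spin_graph_linear[OF S] by (simp add: m_derivation_def so_def)
qed

text \<open>Testing the derivation property against the tensor dual to \<open>\<beta>\<close> turns it into
  \<open>tr (u (A* v)) = 2 tr (u v S)\<close>. By the Clifford relation the left side is a multiple of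
  \<open>(u, A* v)\<close>, and symmetrizing in \<open>u\<close> and \<open>v\<close> makes the right side a multiple of \<open>(u, v)\<close>.\<close>

lemma m_derivation_conformal:
  assumes "m_derivation A S"
  shows "\<exists>k. \<forall>u v. form (A u) v + form u (A v) = k * form u v"
proof -
  interpret A: Vector_Spaces.linear scaleV scaleV A using assms by (simp add: m_derivation_def)
  interpret S: Vector_Spaces.linear scaleW scaleW S using assms by (simp add: m_derivation_def)
  obtain B d where "dual_bases scaleW beta (- eps) B d"
    using WF.ex_dual_bases by blast
  then interpret D: dual_bases scaleW beta "- eps" B d .
  let ?N = "of_nat (card B) :: 'k"
  have "B \<noteq> {}"
    using W_nonzero D.expand by auto
  then have N: "?N \<noteq> 0"
    using char_zero[of "card B"] D.finite_basis by auto
  have eps_nonzero: "eps \<noteq> 0"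
    using eps_square by auto
  have key: "?N * form (A u) v = - 2 * D.tr (\<lambda>s. cliff u (cliff v (S s)))" for u v
  proof -
    have "\<exists>y. \<forall>x. form x y = form (A x) v"
      by (rule VF.dual_vector_exists) (simp_all add: A.add A.scale VF.add_left VF.scale_left)
    then obtain y where y: "form x y = form (A x) v" for x
      by blast
    have der: "beta (cliff y s) t = beta (cliff v (S s)) t + beta (cliff v s) (S t)" for s t
    proof -
      have "beta (cliff y s) t = form (A (bracketW s t)) v"
        by (simp add: y flip: form_bracketW)
      then show ?thesis
        by (simp add: m_derivation_bracketW[OF assms] VF.add_left form_bracketW)
    qed
    \<comment> \<open>the contribution of \<open>[s, S t]\<close>: exchanging the two factors of the dual tensor and cyclicity
      of the trace turn it into the contribution of \<open>[S s, t]\<close>\<close>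
    have "(\<Sum>c\<in>B. beta (cliff v c) (S (cliff u (d c)))) =
        - eps * (\<Sum>c\<in>B. beta (cliff v (d c)) (S (cliff u c)))"
      by (rule D.tensor_swap) (simp_all add: cliff_add_right cliff_scale_right S.add S.scale
          WF.add_left WF.add_right WF.scale_left WF.scale_right)
    also have "\<dots> = (\<Sum>c\<in>B. beta (S (cliff u c)) (cliff v (d c)))"
      by (simp only: sum_distrib_left flip: beta_swap)
    also have "\<dots> = eps * D.tr (\<lambda>s. cliff v (S (cliff u s)))"
      by (simp add: D.tr_def beta_cliff_right sum_distrib_left)
    also have "D.tr (\<lambda>s. cliff v (S (cliff u s))) = D.tr (\<lambda>s. cliff u (cliff v (S s)))"
      by (rule D.tr_commute)
        (simp_all add: linear_cliff Vector_Spaces.linear_iff W.vector_space_axioms S.add S.scale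
          cliff_add_right cliff_scale_right)
    finally have "(\<Sum>c\<in>B. beta (cliff y c) (cliff u (d c))) =
        2 * (eps * D.tr (\<lambda>s. cliff u (cliff v (S s))))"
      by (simp add: der sum.distrib) (simp add: beta_cliff_right D.tr_def sum_distrib_left)
    moreover have "(\<Sum>c\<in>B. beta (cliff y c) (cliff u (d c))) =
        eps * D.tr (\<lambda>s. cliff u (cliff y s))"
      by (simp add: beta_cliff_right D.tr_def sum_distrib_left)
    ultimately have tr_uy: "D.tr (\<lambda>s. cliff u (cliff y s)) =
        2 * D.tr (\<lambda>s. cliff u (cliff v (S s)))"
      using eps_nonzero by (metis mult.left_commute mult_left_cancel)
    have "2 * D.tr (\<lambda>s. cliff u (cliff y s)) =
        D.tr (\<lambda>s. cliff u (cliff y s) + cliff y (cliff u s))"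
      by (simp add: D.tr_add D.tr_commute[OF linear_cliff linear_cliff, of y u])
    also have "\<dots> = - 2 * form u y * ?N"
      using D.tr_scale[of "- 2 * form u y" "\<lambda>s. s"] by (simp add: cliff_clifford D.tr_id)
    finally have "2 * (?N * form u y) = 2 * (- D.tr (\<lambda>s. cliff u (cliff y s)))"
      by (simp add: mult_ac)
    then have "?N * form u y = - D.tr (\<lambda>s. cliff u (cliff y s))"
      using two_nonzero mult_left_cancel by blast
    then show ?thesis
      by (simp add: tr_uy y)
  qed
  have "form (A u) v + form u (A v) = (4 * D.tr S / ?N) * form u v" for u v
  proof -
    have "?N * (form (A u) v + form u (A v)) =
        - 2 * (D.tr (\<lambda>s. cliff u (cliff v (S s))) + D.tr (\<lambda>s. cliff v (cliff u (S s))))"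
      by (simp add: key form_sym[of u] distrib_left)
    also have "\<dots> = - 2 * D.tr (\<lambda>s. cliff u (cliff v (S s)) + cliff v (cliff u (S s)))"
      by (simp add: D.tr_add)
    also have "\<dots> = 4 * form u v * D.tr S"
      by (simp add: cliff_clifford D.tr_scale del: W.scale_minus_left)
    finally show ?thesis
      using N by (simp add: field_simps)
  qed
  then show ?thesis by blast
qed

lemma m_derivation_so_part:
  assumes "m_derivation A S"
  shows "\<exists>k. (\<lambda>v. A v - scaleV k v) \<in> so"
proof -
  interpret A: Vector_Spaces.linear scaleV scaleV A using assms by (simp add: m_derivation_def)
  obtain k where k: "form (A u) v + form u (A v) = k * form u v" for u v
    using m_derivation_conformal[OF assms] by blast
  have half: "k / 2 * x + k / 2 * x = k * x" for x
    using two_nonzero by (simp add: field_simps)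
  have "(\<lambda>v. A v - scaleV (k / 2) v) \<in> so"
  proof (rule soI)
    fix v u
    have "form (A v - scaleV (k / 2) v) u + form v (A u - scaleV (k / 2) u) =
        form (A v) u + form v (A u) - (k / 2 * form v u + k / 2 * form v u)"
      by (simp add: VF.diff_left VF.diff_right VF.scale_left VF.scale_right)
    then show "form (A v - scaleV (k / 2) v) u + form v (A u - scaleV (k / 2) u) = 0"
      by (simp only: half k) simp
  qed (simp_all add: A.add A.scale V.scale_right_distrib V.scale_right_diff_distrib
      mult.commute)
  then show ?thesis by blast
qed

lemma ex_nonnull: "\<exists>u. form u u \<noteq> 0"
proof (rule ccontr)
  assume "\<not> ?thesis"
  then have null: "form u u = 0" for u by simp
  have "form v u = 0" for v u
    using null[of "v + u"] null[of v] null[of u] two_nonzero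
    by (simp add: VF.add_left VF.add_right form_sym[of u v] flip: mult_2)
  then show False
    using V_nonzero form_nondegenerate by blast
qed

text \<open>Vanishing on \<open>V\<close> means \<open>v S = - S* v\<close> in \<open>End W\<close>, where \<open>S*\<close> is the \<open>\<beta>\<close>-adjoint.
  Multiplying by \<open>v\<close> from both sides gives \<open>S v = - v S*\<close> for \<open>v\<close> with \<open>(v, v) \<noteq> 0\<close>, hence for
  all \<open>v\<close>, since such vectors span \<open>V\<close>. So \<open>S\<close> anticommutes with \<open>V\<close> up to the involution
  \<open>S \<mapsto> S*\<close>, and commutes with products of two vectors.\<close>

lemma vertical_derivation_cliff:
  assumes "m_derivation (\<lambda>v. 0) S"
  shows "S (cliff v (cliff u s)) = cliff v (cliff u (S s))"
proof -
  interpret S: Vector_Spaces.linear scaleW scaleW S using assms by (simp add: m_derivation_def)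
  have H: "beta (cliff v (S s)) t = - beta (cliff v s) (S t)" for v s t
  proof -
    have "form (bracketW (S s) t + bracketW s (S t)) v = 0"
      using m_derivation_bracketW[OF assms, of s t] by simp
    then show ?thesis
      by (simp add: VF.add_left form_bracketW eq_neg_iff_add_eq_0)
  qed
  \<comment> \<open>the form that represents \<open>S v + v S*\<close>\<close>
  define \<tau> where "\<tau> v s t = beta (S (cliff v s)) t + eps * beta s (S (cliff v t))" for v s t
  have \<tau>_add: "\<tau> (v + u) s t = \<tau> v s t + \<tau> u s t" for v u s t
    by (simp add: \<tau>_def cliff_add_left S.add WF.add_left WF.add_right distrib_left)
  have \<tau>_nonnull: "\<tau> v s t = 0" if "form v v \<noteq> 0" for v s t
  proof -
    \<comment> \<open>\<open>v\<close> acts with square \<open>-(v,v)\<close>, so that \<open>H\<close> at \<open>v s\<close> and \<open>v t\<close> is the claim up to sign and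
      a factor \<open>(v,v)\<close>\<close>
    have sq: "cliff v (cliff v s) = scaleW (- form v v) s" for s
    proof -
      have "scaleW 2 (cliff v (cliff v s)) = scaleW 2 (scaleW (- form v v) s)"
        using cliff_clifford[of v v s] W.scale_left_distrib[of 1 1 "cliff v (cliff v s)"]
        by simp
      then show ?thesis
        using two_nonzero by (simp only: W.scale_cancel_left) simp
    qed
    have "beta (cliff v (S (cliff v s))) (cliff v t) =
        - form v v * eps * beta (S (cliff v s)) t"
      by (simp only: beta_cliff_right sq WF.scale_left mult_ac)
    moreover have "beta (cliff v (cliff v s)) (S (cliff v t)) =
        - form v v * beta s (S (cliff v t))"
      by (simp only: sq WF.scale_left)
    ultimately have "form v v * (eps * beta (S (cliff v s)) t + beta s (S (cliff v t))) = 0"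
      using H[of v "cliff v s" "cliff v t"] by (simp add: algebra_simps)
    then have "eps * (eps * beta (S (cliff v s)) t + beta s (S (cliff v t))) = 0"
      using that by simp
    then show ?thesis
      by (simp add: \<tau>_def distrib_left eps_square flip: mult.assoc)
  qed
  have \<tau>_zero: "\<tau> v s t = 0" for v s t
  proof (cases "form v v = 0")
    case True
    \<comment> \<open>one of \<open>v + u\<close> and \<open>v - u\<close> is not null, and \<open>\<tau>\<close> is additive\<close>
    obtain u where u: "form u u \<noteq> 0"
      using ex_nonnull by blast
    have "form (v + u) (v + u) + form (v - u) (v - u) = 2 * form u u"
      by (simp add: VF.add_left VF.add_right VF.diff_left VF.diff_right True)
    then have "form (v + u) (v + u) \<noteq> 0 \<or> form (v - u) (v - u) \<noteq> 0"
      using u two_nonzero by auto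
    then show ?thesis
      using \<tau>_nonnull[OF u] \<tau>_nonnull[of "v + u"] \<tau>_nonnull[of "v - u"]
        \<tau>_add[of v u s t] \<tau>_add[of "v - u" u s t] by auto
  qed (rule \<tau>_nonnull)
  show ?thesis
  proof (rule WF.eqI_left)
    fix t
    have "beta (S (cliff v (cliff u s))) t = - eps * beta (cliff u s) (S (cliff v t))"
      using \<tau>_zero[of v "cliff u s" t] by (simp add: \<tau>_def eq_neg_iff_add_eq_0)
    also have "\<dots> = eps * beta (cliff u (S s)) (cliff v t)"
      by (simp add: H)
    also have "\<dots> = beta (cliff v (cliff u (S s))) t"
      by (simp add: beta_cliff_left)
    finally show "beta (S (cliff v (cliff u s))) t = beta (cliff v (cliff u (S s))) t" .
  qed
qed

lemma vertical_derivation_spin_graph: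
  assumes "spin_graph A T" and S: "m_derivation (\<lambda>v. 0) S"
  shows "S (T s) = T (S s)"
proof -
  interpret S: Vector_Spaces.linear scaleW scaleW S using S by (simp add: m_derivation_def)
  show ?thesis
    using assms(1)
    by (induction)
      (simp_all add: act_spin_generator S.add S.diff S.scale vertical_derivation_cliff[OF S])
qed

end


section \<open>Prolongations on other underlying spaces\<close>

context vector_space
begin

lemma fin_dim_subspace:
  assumes "subspace S" "S \<subseteq> span C" "finite C"
  shows "fin_dim scale S"
proof -
  obtain B where B: "B \<subseteq> S" "independent B" "S \<subseteq> span B"
    using maximal_independent_subset[of S] by blast
  have "finite B"
    using independent_span_bound[OF assms(3) B(2)] B(1) assms(2) by auto
  moreover have "S = span B"
    using B(3) span_minimal[OF B(1) assms(1)] by blast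
  ultimately show ?thesis
    by (auto simp: fin_dim_def)
qed

text \<open>Maximality is tested on prolongations whose underlying space consists of finitely supported
  sequences. A basis enumerated by natural numbers moves any finite-dimensional candidate there.\<close>

lemma fin_dim_embeds_into_sequences:
  assumes "fin_dim scale U"
  shows "\<exists>\<iota>. Vector_Spaces.linear scale seq_scale \<iota> \<and> inj_on \<iota> U"
proof -
  interpret Seq: vector_space "seq_scale :: 'a \<Rightarrow> _"
    by (rule vector_space_seq_scale)
  interpret P: vector_space_pair scale "seq_scale :: 'a \<Rightarrow> _" ..
  obtain C where C: "finite C" "U = span C"
    using assms by (auto simp: fin_dim_def)
  obtain B where B: "B \<subseteq> C" "independent B" "C \<subseteq> span B"
    using maximal_independent_subset[of C] by blast
  have finB: "finite B"
    using B(1) C(1) finite_subset by blast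
  have U: "U = span B"
    using C(2) B(1,3) by (metis span_minimal span_mono subspace_span subset_antisym)
  obtain h :: "'b \<Rightarrow> nat" where h: "inj_on h B"
    using finite_imp_inj_to_nat_seg[OF finB] by auto
  obtain \<iota> where \<iota>: "Vector_Spaces.linear scale seq_scale \<iota>"
      "\<And>c. c \<in> B \<Longrightarrow> \<iota> c = Poly_Mapping.single (h c) 1"
    using P.linear_independent_extend[OF B(2), of "\<lambda>c. Poly_Mapping.single (h c) 1"] by blast
  interpret I: Vector_Spaces.linear scale seq_scale \<iota> by (rule \<iota>(1))
  have "inj_on \<iota> U"
    unfolding I.inj_on_iff_eq_0[OF subspace_span[of B, folded U]]
  proof (intro ballI impI)
    fix x assume x: "x \<in> U" "\<iota> x = 0"
    then obtain a where a: "x = (\<Sum>c\<in>B. scale (a c) c)"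
      using span_finite[OF finB] by (auto simp: U)
    have "a e = 0" if e: "e \<in> B" for e
    proof -
      have "0 = Poly_Mapping.lookup (\<iota> x) (h e)"
        using x(2) by simp
      also have "\<dots> = (\<Sum>c\<in>B. a c * Poly_Mapping.lookup (\<iota> c) (h e))"
        by (simp add: a I.sum I.scale lookup_sum lookup_seq_scale)
      also have "\<dots> = (\<Sum>c\<in>B. if c = e then a c else 0)"
        using e h by (intro sum.cong refl) (auto simp: \<iota>(2) lookup_single when_def inj_on_def)
      also have "\<dots> = a e"
        using finB e by simp
      finally show ?thesis by simp
    qed
    then show "x = 0"
      by (simp add: a)
  qed
  with \<iota>(1) show ?thesis by blast
qed

end

context graded_lie_algebra
begin

lemma gr_in_graded_space: "x \<in> gr p \<Longrightarrow> x \<in> graded_space scale gr"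
  unfolding graded_space_def by (intro span_base) auto

lemma subspace_graded_space: "subspace (graded_space scale gr)"
  unfolding graded_space_def by (rule subspace_span)

lemma br_closed:
  assumes "x \<in> graded_space scale gr" "y \<in> graded_space scale gr"
  shows "br x y \<in> graded_space scale gr"
proof -
  let ?U = "graded_space scale gr"
  have sub: "0 \<in> ?U" "\<And>x y. x \<in> ?U \<Longrightarrow> y \<in> ?U \<Longrightarrow> x + y \<in> ?U" "\<And>c x. x \<in> ?U \<Longrightarrow> scale c x \<in> ?U"
    using subspace_graded_space by (auto simp: subspace_def)
  have zero: "br 0 y = 0" "br y 0 = 0" if "y \<in> ?U" for y
    using br_scale_left[OF sub(1) that, of 0] br_scale_right[OF that sub(1), of 0] by simp_all
  have hom: "br x y \<in> ?U" if "x \<in> gr p" "y \<in> ?U" for x p y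
  proof -
    have x: "x \<in> ?U" by (rule gr_in_graded_space[OF that(1)])
    have "y \<in> ?U \<and> br x y \<in> ?U"
      using that(2) unfolding graded_space_def
    proof (rule span_induct)
      show "y \<in> span (\<Union>p. gr p) \<and> br x y \<in> span (\<Union>p. gr p)" if "y \<in> (\<Union>p. gr p)" for y
        using that br_gr[OF \<open>x \<in> gr p\<close>] gr_in_graded_space unfolding graded_space_def by blast
      show "subspace {a. a \<in> span (\<Union>p. gr p) \<and> br x a \<in> span (\<Union>p. gr p)}"
        unfolding graded_space_def[symmetric] subspace_def
        using x sub zero by (simp add: br_add_right br_scale_right)
    qed
    then show ?thesis by simp
  qed
  have "x \<in> ?U \<and> br x y \<in> ?U"
    using assms(1) unfolding graded_space_def
  proof (rule span_induct)
    show "x \<in> span (\<Union>p. gr p) \<and> br x y \<in> span (\<Union>p. gr p)" if "x \<in> (\<Union>p. gr p)" for x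
      using that hom[OF _ assms(2)] gr_in_graded_space unfolding graded_space_def by blast
    show "subspace {a. a \<in> span (\<Union>p. gr p) \<and> br a y \<in> span (\<Union>p. gr p)}"
      unfolding graded_space_def[symmetric] subspace_def
      using assms(2) sub zero by (simp add: br_add_left br_scale_left)
  qed
  then show ?thesis by simp
qed

end

context extended_translation_algebra
begin

lemma vector_space_m_scale: "vector_space m_scale"
  by unfold_locales
    (simp_all add: m_scale_def prod_eq_iff V.scale_right_distrib V.scale_left_distrib
      W.scale_right_distrib W.scale_left_distrib)

lemma graded_space_m: "graded_space m_scale m_gr = UNIV"
proof -
  interpret M: vector_space m_scale by (rule vector_space_m_scale)
  have "x \<in> M.span (\<Union>p. m_gr p)" for x
  proof -
    have "(fst x, 0) \<in> m_gr (-2)" "(0, snd x) \<in> m_gr (-1)"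
      by (simp_all add: m_gr_def)
    then have "(fst x, 0) + (0, snd x) \<in> M.span (\<Union>p. m_gr p)"
      by (intro M.span_add M.span_base) blast+
    then show ?thesis by simp
  qed
  then show ?thesis
    by (auto simp: graded_space_def)
qed

end

context transitive_prolongation
begin

lemma emb_add: "emb (x + y) = emb x + emb y"
  and emb_scale: "emb (m_scale c x) = scale c (emb x)"
  and emb_br: "emb (m_br x y) = br (emb x) (emb y)"
  using emb_hom by (simp_all add: graded_lie_hom_def graded_space_m del: split_paired_All)

lemma emb_in_gr: "emb (v, 0) \<in> gr (-2)" "emb (0, s) \<in> gr (-1)"
  using emb_negative[of "-2"] emb_negative[of "-1"] by (auto simp: m_gr_def)

lemma emb_in_graded_space: "emb x \<in> graded_space scale gr"
proof -
  have "emb (fst x, 0) + emb (0, snd x) \<in> graded_space scale gr"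
    by (intro subspace_add[OF subspace_graded_space] gr_in_graded_space[OF emb_in_gr(1)]
        gr_in_graded_space[OF emb_in_gr(2)])
  then show ?thesis
    by (simp flip: emb_add)
qed

text \<open>Only the graded space has to be embedded; outside of its image the transported bracket takes
  the arbitrary values that \<open>inv_into\<close> provides.\<close>

lemma transport:
  fixes scale' :: "'k \<Rightarrow> 'h::ab_group_add \<Rightarrow> 'h"
  assumes lin: "Vector_Spaces.linear scale scale' \<iota>"
    and inj: "inj_on \<iota> (graded_space scale gr)"
  defines "j \<equiv> inv_into (graded_space scale gr) \<iota>"
  shows "transitive_prolongation scaleV form scaleW act beta scale'
      (\<lambda>x y. \<iota> (br (j x) (j y))) (\<lambda>p. \<iota> ` gr p) (\<iota> \<circ> emb)"
    and "graded_space scale' (\<lambda>p. \<iota> ` gr p) = \<iota> ` graded_space scale gr"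
    and "x \<in> graded_space scale gr \<Longrightarrow> j (\<iota> x) = x"
proof -
  let ?U = "graded_space scale gr"
  interpret I: Vector_Spaces.linear scale scale' \<iota> by (rule lin)
  have [simp]: "j (\<iota> x) = x" if "x \<in> ?U" for x
    unfolding j_def by (rule inv_into_f_f[OF inj that])
  then show "x \<in> ?U \<Longrightarrow> j (\<iota> x) = x" .
  note U[simp] = subspace_0[OF subspace_graded_space] subspace_add[OF subspace_graded_space]
    subspace_scale[OF subspace_graded_space] gr_in_graded_space br_closed emb_in_graded_space
  show space: "graded_space scale' (\<lambda>p. \<iota> ` gr p) = \<iota> ` ?U"
    unfolding graded_space_def I.span_image[symmetric] by (simp add: image_UN)
  show "transitive_prolongation scaleV form scaleW act beta scale'
      (\<lambda>x y. \<iota> (br (j x) (j y))) (\<lambda>p. \<iota> ` gr p) (\<iota> \<circ> emb)"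
  proof unfold_locales
    show "I.vs2.subspace (\<iota> ` gr p)" for p
      by (rule I.subspace_image[OF gr_subspace])
    show "f p = 0" if P: "finite P" "\<And>p. p \<in> P \<Longrightarrow> f p \<in> \<iota> ` gr p" "sum f P = 0" "p \<in> P" for P f p
    proof -
      have "\<forall>p\<in>P. \<exists>y. y \<in> gr p \<and> f p = \<iota> y"
        using P(2) by blast
      then obtain g where g: "\<And>p. p \<in> P \<Longrightarrow> g p \<in> gr p" "\<And>p. p \<in> P \<Longrightarrow> f p = \<iota> (g p)"
        by metis
      have "\<iota> (sum g P) = \<iota> 0"
        using P(3) g(2) by (simp add: I.sum)
      moreover have "sum g P \<in> ?U"
        by (intro subspace_sum[OF subspace_graded_space] gr_in_graded_space[OF g(1)])
      ultimately have "sum g P = 0"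
        using inj_onD[OF inj, of "sum g P" 0] by simp
      then have "g p = 0"
        using gr_independent[OF P(1) g(1) _ P(4)] by blast
      then show ?thesis
        using g(2)[OF P(4)] by simp
    qed
    show "\<iota> (br (j x) (j y)) \<in> \<iota> ` gr (p + q)" if "x \<in> \<iota> ` gr p" "y \<in> \<iota> ` gr q" for x y p q
      using that br_gr by fastforce
    show "\<iota> (br (j (x + y)) (j z)) = \<iota> (br (j x) (j z)) + \<iota> (br (j y) (j z))"
      if "x \<in> graded_space scale' (\<lambda>p. \<iota> ` gr p)" "y \<in> graded_space scale' (\<lambda>p. \<iota> ` gr p)"
        "z \<in> graded_space scale' (\<lambda>p. \<iota> ` gr p)" for x y z
      using that unfolding space by (auto simp: br_add_left simp flip: I.add)
    show "\<iota> (br (j z) (j (x + y))) = \<iota> (br (j z) (j x)) + \<iota> (br (j z) (j y))"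
      if "z \<in> graded_space scale' (\<lambda>p. \<iota> ` gr p)" "x \<in> graded_space scale' (\<lambda>p. \<iota> ` gr p)"
        "y \<in> graded_space scale' (\<lambda>p. \<iota> ` gr p)" for x y z
      using that unfolding space by (auto simp: br_add_right simp flip: I.add)
    show "\<iota> (br (j (scale' c x)) (j y)) = scale' c (\<iota> (br (j x) (j y)))"
      if "x \<in> graded_space scale' (\<lambda>p. \<iota> ` gr p)" "y \<in> graded_space scale' (\<lambda>p. \<iota> ` gr p)" for x y c
      using that unfolding space by (auto simp: br_scale_left simp flip: I.scale)
    show "\<iota> (br (j x) (j (scale' c y))) = scale' c (\<iota> (br (j x) (j y)))"
      if "x \<in> graded_space scale' (\<lambda>p. \<iota> ` gr p)" "y \<in> graded_space scale' (\<lambda>p. \<iota> ` gr p)" for x y c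
      using that unfolding space by (auto simp: br_scale_right simp flip: I.scale)
    show "\<iota> (br (j x) (j x)) = 0" if "x \<in> graded_space scale' (\<lambda>p. \<iota> ` gr p)" for x
      using that unfolding space by (auto simp: br_self)
    show "\<iota> (br (j x) (j (\<iota> (br (j y) (j z))))) + \<iota> (br (j y) (j (\<iota> (br (j z) (j x)))))
        + \<iota> (br (j z) (j (\<iota> (br (j x) (j y))))) = 0"
      if "x \<in> graded_space scale' (\<lambda>p. \<iota> ` gr p)" "y \<in> graded_space scale' (\<lambda>p. \<iota> ` gr p)"
        "z \<in> graded_space scale' (\<lambda>p. \<iota> ` gr p)" for x y z
      using that unfolding space by (auto simp: jacobi simp flip: I.add)
    show "fin_dim scale' (\<iota> ` gr p)" for p
      using gr_fin_dim[of p] I.span_image unfolding fin_dim_def by (metis finite_imageI)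
    show "graded_lie_hom m_scale m_br m_gr scale' (\<lambda>x y. \<iota> (br (j x) (j y)))
        (\<lambda>p. \<iota> ` gr p) (\<iota> \<circ> emb)"
      using emb_hom by (auto simp: graded_lie_hom_def emb_add emb_scale emb_br I.add I.scale)
    show "inj (\<iota> \<circ> emb)"
      by (rule comp_inj_on[OF emb_inj inj_on_subset[OF inj]]) (use emb_in_graded_space in blast)
    show "(\<iota> \<circ> emb) ` m_gr p = \<iota> ` gr p" if "p < 0" for p
      by (simp only: emb_negative[OF that] flip: image_comp)
    show "X = 0" if p: "p \<ge> 0" "X \<in> \<iota> ` gr p" and X: "\<And>Y. Y \<in> \<iota> ` gr (-1) \<Longrightarrow> \<iota> (br (j X) (j Y)) = 0"
      for p X
    proof -
      obtain x where x: "x \<in> gr p" "X = \<iota> x"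
        using p(2) by blast
      have "br x y = 0" if "y \<in> gr (-1)" for y
      proof -
        have xy: "x \<in> ?U" "y \<in> ?U"
          using gr_in_graded_space x(1) that by blast+
        then have "\<iota> (br x y) = \<iota> 0"
          using X[of "\<iota> y"] that x(2) by simp
        then show ?thesis
          using inj_onD[OF inj, of "br x y" 0] xy by simp
      qed
      then have "x = 0"
        by (rule transitive[OF p(1) x(1)])
      then show ?thesis
        using x(2) by simp
    qed
  qed
qed

end

lemma maximal_prolongation_receives:
  fixes scaleV :: "'k::field \<Rightarrow> 'v::ab_group_add \<Rightarrow> 'v"
    and scaleW :: "'k \<Rightarrow> 'w::ab_group_add \<Rightarrow> 'w"
    and scale' :: "'k \<Rightarrow> 'h::ab_group_add \<Rightarrow> 'h"
  assumes "maximal_transitive_prolongation scaleV form scaleW act beta scale br gr emb"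
    and "transitive_prolongation scaleV form scaleW act beta scale' br' gr' emb'"
    and "fin_dim scale' (graded_space scale' gr')"
  shows "\<exists>f. graded_lie_hom scale' br' gr' scale br gr f \<and> inj_on f (graded_space scale' gr')"
proof -
  interpret T: transitive_prolongation scaleV form scaleW act beta scale' br' gr' emb'
    by (rule assms(2))
  obtain \<iota> where lin: "Vector_Spaces.linear scale' seq_scale \<iota>"
      and inj: "inj_on \<iota> (graded_space scale' gr')"
    using T.fin_dim_embeds_into_sequences[OF assms(3)] by blast
  interpret I: Vector_Spaces.linear scale' seq_scale \<iota> by (rule lin)
  define j where "j = inv_into (graded_space scale' gr') \<iota>"
  note tr = T.transport[OF lin inj, folded j_def]
  obtain f where f: "graded_lie_hom seq_scale (\<lambda>x y. \<iota> (br' (j x) (j y))) (\<lambda>p. \<iota> ` gr' p) scale br gr f"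
      and f_inj: "inj_on f (\<iota> ` graded_space scale' gr')"
    using assms(1) tr(1) unfolding maximal_transitive_prolongation_def tr(2)[symmetric] by blast
  have "graded_lie_hom scale' br' gr' scale br gr (f \<circ> \<iota>)"
    unfolding graded_lie_hom_def
  proof (intro conjI ballI allI)
    note f' = f[unfolded graded_lie_hom_def tr(2)]
    show "(f \<circ> \<iota>) (x + y) = (f \<circ> \<iota>) x + (f \<circ> \<iota>) y"
      if "x \<in> graded_space scale' gr'" "y \<in> graded_space scale' gr'" for x y
      using f' that by (simp add: I.add)
    show "(f \<circ> \<iota>) (scale' c x) = scale c ((f \<circ> \<iota>) x)" if "x \<in> graded_space scale' gr'" for c x
      using f' that by (simp add: I.scale)
    show "(f \<circ> \<iota>) (br' x y) = br ((f \<circ> \<iota>) x) ((f \<circ> \<iota>) y)"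
      if "x \<in> graded_space scale' gr'" "y \<in> graded_space scale' gr'" for x y
    proof -
      have "f (\<iota> (br' (j (\<iota> x)) (j (\<iota> y)))) = br (f (\<iota> x)) (f (\<iota> y))"
        using f' that by blast
      then show ?thesis
        using that by (simp add: tr(3))
    qed
    show "(f \<circ> \<iota>) ` gr' p \<subseteq> gr p" for p
      using f' by (auto simp: image_comp)
  qed
  moreover have "inj_on (f \<circ> \<iota>) (graded_space scale' gr')"
    by (rule comp_inj_on[OF inj f_inj])
  ultimately show ?thesis by blast
qed


section \<open>The prolongation \<open>\<mm> + Der(\<mm>)\<close>\<close>

text \<open>The underlying space contains all pairs of self-maps of \<open>V\<close> and \<open>W\<close>, also nonlinear ones; the
  grading selects the derivations. In each degree all components but the one of that degree are
  required to vanish.\<close>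

type_synonym ('a, 'b) ext = "'a \<times> 'b \<times> ('a \<Rightarrow> 'a) \<times> ('b \<Rightarrow> 'b)"

context char_zero_translation_algebra
begin

lemma cliff_faithful:
  assumes "\<And>s. cliff v s = 0"
  shows "v = 0"
proof (rule VF.nondegenerate)
  fix u
  obtain s :: 'w where "s \<noteq> 0"
    using W_nonzero by blast
  then show "form v u = 0"
    using cliff_clifford[of v u s] two_nonzero by (simp add: assms)
qed

text \<open>The brackets \<open>[s,t]\<close> span \<open>V\<close>: a functional that kills them is \<open>(y, \<cdot>)\<close> for some \<open>y\<close>
  acting on \<open>W\<close> by zero.\<close>

lemma m_derivation_zero:
  assumes "m_derivation A (\<lambda>s. 0)"
  shows "A v = 0"
proof (rule VF.nondegenerate)
  fix u
  interpret A: Vector_Spaces.linear scaleV scaleV A using assms by (simp add: m_derivation_def)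
  have "\<exists>y. \<forall>x. form x y = form (A x) u"
    by (rule VF.dual_vector_exists) (simp_all add: A.add A.scale VF.add_left VF.scale_left)
  then obtain y where y: "form x y = form (A x) u" for x
    by blast
  have "beta (cliff y s) t = 0" for s t
    using y[of "bracketW s t"] m_derivation_bracketW[OF assms, of s t] by (simp add: form_bracketW)
  then have "y = 0"
    by (intro cliff_faithful WF.nondegenerate)
  then show "form (A v) u = 0"
    using y[of v] by simp
qed

definition ext_scale :: "'k \<Rightarrow> ('v, 'w) ext \<Rightarrow> ('v, 'w) ext" where
  "ext_scale c = (\<lambda>(v, w, A, S). (scaleV c v, scaleW c w, \<lambda>x. scaleV c (A x), \<lambda>x. scaleW c (S x)))"

definition ext_br :: "('v, 'w) ext \<Rightarrow> ('v, 'w) ext \<Rightarrow> ('v, 'w) ext" where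
  "ext_br = (\<lambda>(v, w, A, S) (v', w', A', S').
     (A v' - A' v + bracketW w w', S w' - S' w,
      \<lambda>x. A (A' x) - A' (A x), \<lambda>x. S (S' x) - S' (S x)))"

definition ext_gr :: "int \<Rightarrow> ('v, 'w) ext set" where
  "ext_gr p = {(v, w, A, S). m_derivation A S \<and> (p \<noteq> -2 \<longrightarrow> v = 0) \<and> (p \<noteq> -1 \<longrightarrow> w = 0) \<and>
     (p \<noteq> 0 \<longrightarrow> A = 0 \<and> S = 0)}"

definition ext_emb :: "'v \<times> 'w \<Rightarrow> ('v, 'w) ext" where
  "ext_emb = (\<lambda>(v, w). (v, w, 0, 0))"

lemma vector_space_ext_scale: "vector_space ext_scale"
  by unfold_locales
    (auto simp: ext_scale_def fun_eq_iff V.scale_right_distrib V.scale_left_distrib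
      W.scale_right_distrib W.scale_left_distrib)

lemma m_derivation_0: "m_derivation 0 0"
  using m_derivation_scale[OF m_derivation_grading, of 0] by (simp add: zero_fun_def)

lemma m_derivation_plus: "m_derivation A S \<Longrightarrow> m_derivation B T \<Longrightarrow> m_derivation (A + B) (S + T)"
  using m_derivation_add by (simp add: plus_fun_def)

lemma subspace_derivations:
  "module.subspace ext_scale {(v, w, A, S). m_derivation A S \<and> P v \<and> Q w \<and> (R \<longrightarrow> A = 0 \<and> S = 0)}"
  if "P 0" "\<And>v u. P v \<Longrightarrow> P u \<Longrightarrow> P (v + u)" "\<And>c v. P v \<Longrightarrow> P (scaleV c v)"
    "Q 0" "\<And>v u. Q v \<Longrightarrow> Q u \<Longrightarrow> Q (v + u)" "\<And>c v. Q v \<Longrightarrow> Q (scaleW c v)"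
proof -
  interpret X: vector_space ext_scale by (rule vector_space_ext_scale)
  show ?thesis
  proof (rule X.subspaceI, goal_cases)
    case 1
    show ?case
      using that by (simp add: zero_prod_def m_derivation_0)
  next
    case (2 x y)
    then show ?case
      using that by (cases x; cases y) (simp add: m_derivation_plus)
  next
    case (3 c x)
    then show ?case
      using that by (cases x) (auto simp: ext_scale_def m_derivation_scale fun_eq_iff)
  qed
qed

lemma graded_space_ext: "graded_space ext_scale ext_gr = {(v, w, A, S). m_derivation A S}"
proof -
  interpret X: vector_space ext_scale by (rule vector_space_ext_scale)
  have "x \<in> X.span (\<Union>p. ext_gr p)" if xU: "x \<in> {(v, w, A, S). m_derivation A S}" for x
  proof -
    obtain v w A S where x: "x = (v, w, A, S)" "m_derivation A S"
      using xU by auto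
    have "(v, 0, 0, 0) \<in> ext_gr (-2)" "(0, w, 0, 0) \<in> ext_gr (-1)" "(0, 0, A, S) \<in> ext_gr 0"
      using x(2) by (simp_all add: ext_gr_def m_derivation_0)
    then have "(v, 0, 0, 0) + (0, w, 0, 0) + (0, 0, A, S) \<in> X.span (\<Union>p. ext_gr p)"
      by (intro X.span_add X.span_base) blast+
    then show ?thesis
      by (simp add: x)
  qed
  moreover have "X.span (\<Union>p. ext_gr p) \<subseteq> {(v, w, A, S). m_derivation A S}"
  proof (rule X.span_minimal)
    show "X.subspace {(v, w, A, S). m_derivation A S}"
      using subspace_derivations[of "\<lambda>_. True" "\<lambda>_. True" False] by simp
  qed (auto simp: ext_gr_def)
  ultimately show ?thesis
    unfolding graded_space_def by blast
qed

text \<open>Linear endomorphisms are linear combinations of the rank one maps \<open>x \<mapsto> (x, d c) e\<close>.\<close>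

lemma fin_dim_ext: "\<exists>C. finite C \<and> graded_space ext_scale ext_gr \<subseteq> module.span ext_scale C"
proof -
  interpret X: vector_space ext_scale by (rule vector_space_ext_scale)
  obtain B d where "dual_bases scaleV form 1 B d"
    using VF.ex_dual_bases by blast
  then interpret D: dual_bases scaleV form 1 B d .
  obtain B' d' where "dual_bases scaleW beta (- eps) B' d'"
    using WF.ex_dual_bases by blast
  then interpret D': dual_bases scaleW beta "- eps" B' d' .
  define g1 :: "'v \<Rightarrow> ('v, 'w) ext" where "g1 c = (c, 0, 0, 0)" for c
  define g2 :: "'w \<Rightarrow> ('v, 'w) ext" where "g2 c = (0, c, 0, 0)" for c
  define g3 :: "'v \<Rightarrow> 'v \<Rightarrow> ('v, 'w) ext" where "g3 c e = (0, 0, \<lambda>x. scaleV (form x (d c)) e, 0)" for c e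
  define g4 :: "'w \<Rightarrow> 'w \<Rightarrow> ('v, 'w) ext" where "g4 c e = (0, 0, 0, \<lambda>x. scaleW (beta x (d' c)) e)" for c e
  define C where "C = g1 ` B \<union> g2 ` B' \<union> (\<lambda>(c, e). g3 c e) ` (B \<times> B) \<union> (\<lambda>(c, e). g4 c e) ` (B' \<times> B')"
  have in_span: "c \<in> B \<Longrightarrow> g1 c \<in> X.span C" "c' \<in> B' \<Longrightarrow> g2 c' \<in> X.span C"
    "c \<in> B \<Longrightarrow> e \<in> B \<Longrightarrow> g3 c e \<in> X.span C" "c' \<in> B' \<Longrightarrow> e' \<in> B' \<Longrightarrow> g4 c' e' \<in> X.span C" for c c' e e'
    by (rule X.span_base, force simp: C_def)+
  have sum_apply: "(sum f I) x = (\<Sum>i\<in>I. f i x)" for f :: "'i \<Rightarrow> 'x \<Rightarrow> 'y::comm_monoid_add" and I x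
    by (induction I rule: infinite_finite_induct) simp_all
  have "x \<in> X.span C" if "x \<in> graded_space ext_scale ext_gr" for x
  proof -
    obtain v w A S where x: "x = (v, w, A, S)" and AS: "m_derivation A S"
      using \<open>x \<in> _\<close> unfolding graded_space_ext by blast
    interpret A: Vector_Spaces.linear scaleV scaleV A using AS by (simp add: m_derivation_def)
    interpret S: Vector_Spaces.linear scaleW scaleW S using AS by (simp add: m_derivation_def)
    have A: "A y = (\<Sum>c\<in>B. \<Sum>e\<in>B. scaleV (form (A c) (d e)) (scaleV (form y (d c)) e))" for y
    proof -
      have "A y = (\<Sum>c\<in>B. scaleV (form y (d c)) (A c))"
        by (simp add: D.expand flip: A.scale A.sum)
      also have "\<dots> = (\<Sum>c\<in>B. scaleV (form y (d c)) (\<Sum>e\<in>B. scaleV (form (A c) (d e)) e))"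
        by (simp only: D.expand)
      finally show ?thesis
        by (simp add: V.scale_sum_right mult.commute)
    qed
    have S: "S y = (\<Sum>c\<in>B'. \<Sum>e\<in>B'. scaleW (beta (S c) (d' e)) (scaleW (beta y (d' c)) e))" for y
    proof -
      have "S y = (\<Sum>c\<in>B'. scaleW (beta y (d' c)) (S c))"
        by (simp add: D'.expand flip: S.scale S.sum)
      also have "\<dots> = (\<Sum>c\<in>B'. scaleW (beta y (d' c)) (\<Sum>e\<in>B'. scaleW (beta (S c) (d' e)) e))"
        by (simp only: D'.expand)
      finally show ?thesis
        by (simp add: W.scale_sum_right mult.commute)
    qed
    have "x = (\<Sum>c\<in>B. ext_scale (form v (d c)) (g1 c)) + (\<Sum>c\<in>B'. ext_scale (beta w (d' c)) (g2 c))
        + (\<Sum>c\<in>B. \<Sum>e\<in>B. ext_scale (form (A c) (d e)) (g3 c e))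
        + (\<Sum>c\<in>B'. \<Sum>e\<in>B'. ext_scale (beta (S c) (d' e)) (g4 c e))"
      unfolding x g1_def g2_def g3_def g4_def ext_scale_def
      by (simp add: prod_eq_iff fun_eq_iff fst_sum snd_sum sum_apply D.expand D'.expand
          flip: V.scale_scale W.scale_scale A S)
    also have "\<dots> \<in> X.span C"
      by (intro X.span_add X.span_sum X.span_scale in_span)
    finally show ?thesis .
  qed
  moreover have "finite C"
    unfolding C_def using D.finite_basis D'.finite_basis by simp
  ultimately show ?thesis by blast
qed

lemma transitive_prolongation_ext:
  "transitive_prolongation scaleV form scaleW act beta ext_scale ext_br ext_gr ext_emb"
proof -
  interpret X: vector_space ext_scale by (rule vector_space_ext_scale)
  have sub: "X.subspace (ext_gr p)" for p
    using subspace_derivations[of "\<lambda>v. p \<noteq> -2 \<longrightarrow> v = 0" "\<lambda>w. p \<noteq> -1 \<longrightarrow> w = 0" "p \<noteq> 0"]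
    unfolding ext_gr_def by simp
  have U: "ext_gr p \<subseteq> graded_space ext_scale ext_gr" for p
    unfolding graded_space_ext by (auto simp: ext_gr_def)
  note lin = m_derivation_def Vector_Spaces.linear_iff
  have lin_diff: "A (v - v') = A v - A v'" "S (s - s') = S s - S s'"
    if "m_derivation A S" for A S v v' s s'
  proof -
    interpret A: Vector_Spaces.linear scaleV scaleV A using that by (simp add: m_derivation_def)
    interpret S: Vector_Spaces.linear scaleW scaleW S using that by (simp add: m_derivation_def)
    show "A (v - v') = A v - A v'" "S (s - s') = S s - S s'" by (rule A.diff, rule S.diff)
  qed
  have lin_add: "A (v + v') = A v + A v'" "S (s + s') = S s + S s'"
    "A (scaleV c v) = scaleV c (A v)" "S (scaleW c s) = scaleW c (S s)"
    if "m_derivation A S" for A S v v' s s' c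
    using that by (auto simp: lin)
  show ?thesis
  proof unfold_locales
    show "X.subspace (ext_gr p)" for p
      by (rule sub)
    show "f p = 0" if P: "finite P" "\<And>p. p \<in> P \<Longrightarrow> f p \<in> ext_gr p" "sum f P = 0" "p \<in> P" for P f p
    proof -
      \<comment> \<open>the projection onto the component of degree \<open>q\<close>\<close>
      define \<pi> where "\<pi> q = (\<lambda>(v :: 'v, w :: 'w, A :: 'v \<Rightarrow> 'v, S :: 'w \<Rightarrow> 'w).
        (if q = -2 then v else 0, if q = -1 then w else 0,
         if q = 0 then A else 0, if q = 0 then S else 0))" for q :: int
      have \<pi>_add: "\<pi> q (x + y) = \<pi> q x + \<pi> q y" for q x y
        by (cases x; cases y) (simp add: \<pi>_def)
      have \<pi>_0: "\<pi> q 0 = 0" for q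
        by (simp add: \<pi>_def zero_prod_def)
      have \<pi>_gr: "\<pi> p x = (if p = q then x else 0)" if "x \<in> ext_gr q" for x q p
        using that by (auto simp: \<pi>_def ext_gr_def zero_prod_def)
      have "\<pi> p (sum f P) = (\<Sum>q\<in>P. \<pi> p (f q))"
        by (induction P rule: infinite_finite_induct) (simp_all add: \<pi>_add \<pi>_0)
      also have "\<dots> = (\<Sum>q\<in>P. if q = p then f q else 0)"
        by (intro sum.cong refl) (auto simp: \<pi>_gr[OF P(2)])
      also have "\<dots> = f p"
        using P(1,4) by simp
      finally show ?thesis
        by (simp add: P(3) \<pi>_0)
    qed
    show "ext_br x y \<in> ext_gr (p + q)" if "x \<in> ext_gr p" "y \<in> ext_gr q" for x y p q
    proof -
      obtain v w A S v' w' A' S' where x: "x = (v, w, A, S)" and y: "y = (v', w', A', S')"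
        by (metis prod_cases4)
      note x' = that(1)[unfolded x ext_gr_def, simplified] and y' = that(2)[unfolded y ext_gr_def, simplified]
      note m = conjunct1[OF x'] conjunct1[OF y']
      have der: "m_derivation (\<lambda>x. A (A' x) - A' (A x)) (\<lambda>x. S (S' x) - S' (S x))"
        by (rule m_derivation_commutator[OF m])
      have 1: "A v' - A' v + bracketW w w' = 0" if "p + q \<noteq> -2"
      proof -
        have "A v' = 0" using that x' y' m_derivation_at_0[OF m(1)] by (cases "p = 0") auto
        moreover have "A' v = 0" using that x' y' m_derivation_at_0[OF m(2)] by (cases "q = 0") auto
        moreover have "bracketW w w' = 0" using that x' y' by (cases "p = -1") auto
        ultimately show ?thesis by simp
      qed
      have 2: "S w' - S' w = 0" if "p + q \<noteq> -1"
      proof -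
        have "S w' = 0" using that x' y' m_derivation_at_0[OF m(1)] by (cases "p = 0") auto
        moreover have "S' w = 0" using that x' y' m_derivation_at_0[OF m(2)] by (cases "q = 0") auto
        ultimately show ?thesis by simp
      qed
      have 3: "(\<lambda>x. A (A' x) - A' (A x)) = 0 \<and> (\<lambda>x. S (S' x) - S' (S x)) = 0" if "p + q \<noteq> 0"
        using that x' y' m_derivation_at_0[OF m(1)] m_derivation_at_0[OF m(2)] by (cases "p = 0") (auto simp: fun_eq_iff)
      show ?thesis
        using der 1 2 3 by (simp add: x y ext_br_def ext_gr_def)
    qed
    show "ext_br (x + y) z = ext_br x z + ext_br y z"
      if "x \<in> graded_space ext_scale ext_gr" "y \<in> graded_space ext_scale ext_gr"
        "z \<in> graded_space ext_scale ext_gr" for x y z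
      using that unfolding graded_space_ext
      by (auto simp: ext_br_def fun_eq_iff lin_add bracketW_bilinear)
    show "ext_br z (x + y) = ext_br z x + ext_br z y"
      if "z \<in> graded_space ext_scale ext_gr" "x \<in> graded_space ext_scale ext_gr"
        "y \<in> graded_space ext_scale ext_gr" for x y z
      using that unfolding graded_space_ext
      by (auto simp: ext_br_def fun_eq_iff lin_add bracketW_bilinear)
    show "ext_br (ext_scale c x) y = ext_scale c (ext_br x y)"
      if "x \<in> graded_space ext_scale ext_gr" "y \<in> graded_space ext_scale ext_gr" for x y c
      using that unfolding graded_space_ext
      by (auto simp: ext_br_def ext_scale_def fun_eq_iff lin_add bracketW_bilinear
          V.scale_right_diff_distrib W.scale_right_diff_distrib V.scale_right_distrib)
    show "ext_br x (ext_scale c y) = ext_scale c (ext_br x y)"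
      if "x \<in> graded_space ext_scale ext_gr" "y \<in> graded_space ext_scale ext_gr" for x y c
      using that unfolding graded_space_ext
      by (auto simp: ext_br_def ext_scale_def fun_eq_iff lin_add bracketW_bilinear
          V.scale_right_diff_distrib W.scale_right_diff_distrib V.scale_right_distrib)
    show "ext_br x x = 0" for x
      by (cases x) (simp add: ext_br_def bracketW_self zero_prod_def fun_eq_iff)
    show "ext_br x (ext_br y z) + ext_br y (ext_br z x) + ext_br z (ext_br x y) = 0"
      if in_U: "x \<in> graded_space ext_scale ext_gr" "y \<in> graded_space ext_scale ext_gr"
        "z \<in> graded_space ext_scale ext_gr" for x y z
    proof -
      obtain v1 w1 A1 S1 where x: "x = (v1, w1, A1, S1)" "m_derivation A1 S1"
        using in_U(1) unfolding graded_space_ext by blast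
      obtain v2 w2 A2 S2 where y: "y = (v2, w2, A2, S2)" "m_derivation A2 S2"
        using in_U(2) unfolding graded_space_ext by blast
      obtain v3 w3 A3 S3 where z: "z = (v3, w3, A3, S3)" "m_derivation A3 S3"
        using in_U(3) unfolding graded_space_ext by blast
      note der = x(2) y(2) z(2)
      show ?thesis
        unfolding x y z
        by (simp add: ext_br_def zero_prod_def fun_eq_iff der[THEN lin_diff(1)]
            der[THEN lin_diff(2)] der[THEN lin_add(1)] der[THEN m_derivation_bracketW]
            bracketW_diff bracketW_swap[of "S1 w3" w2] bracketW_swap[of "S2 w1" w3]
            bracketW_swap[of "S3 w2" w1] bracketW_swap[of "S1 w2" w3] bracketW_swap[of "S2 w3" w1]
            bracketW_swap[of "S3 w1" w2])
    qed
    show "fin_dim ext_scale (ext_gr p)" for p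
      using fin_dim_ext U[of p] X.fin_dim_subspace[OF sub] by blast
    show "graded_lie_hom m_scale m_br m_gr ext_scale ext_br ext_gr ext_emb"
      unfolding graded_lie_hom_def
      by (auto simp: ext_emb_def m_scale_def m_br_def ext_scale_def ext_br_def m_gr_def ext_gr_def
          fun_eq_iff m_derivation_0 zero_prod_def)
    show "inj ext_emb"
      by (auto simp: inj_def ext_emb_def)
    show "ext_emb ` m_gr p = ext_gr p" if "p < 0" for p
      using that by (auto simp: ext_emb_def m_gr_def ext_gr_def m_derivation_0 image_def zero_prod_def)
    show "X = 0" if p: "p \<ge> 0" "X \<in> ext_gr p" and X: "\<And>Y. Y \<in> ext_gr (-1) \<Longrightarrow> ext_br X Y = 0" for p X
    proof -
      obtain A S where AS: "X = (0, 0, A, S)" "m_derivation A S"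
        using p by (auto simp: ext_gr_def)
      have "S w = 0" for w
        using X[of "(0, w, 0, 0)"]
        by (simp add: AS(1) ext_br_def ext_gr_def m_derivation_0 zero_prod_def)
      then have S: "S = (\<lambda>s. 0)" by blast
      then have "A = 0"
        using m_derivation_zero[OF AS(2)[unfolded S]] by (simp add: fun_eq_iff)
      then show ?thesis
        by (simp add: AS(1) S zero_prod_def zero_fun_def)
    qed
  qed
qed

end


section \<open>The degree zero part of the maximal prolongation\<close>

context graded_lie_algebra
begin

lemma br_swap:
  assumes "x \<in> graded_space scale gr" "y \<in> graded_space scale gr"
  shows "br x y = - br y x"
proof -
  have "br x y + br y x = br (x + y) (x + y)"
    using assms by (simp add: br_add_left br_add_right assms[THEN br_self] subspace_add[OF subspace_graded_space])
  also have "\<dots> = 0"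
    by (intro br_self subspace_add subspace_graded_space assms)
  finally show ?thesis
    by (simp add: eq_neg_iff_add_eq_0)
qed

lemma br_minus_right:
  assumes "x \<in> graded_space scale gr" "y \<in> graded_space scale gr"
  shows "br x (- y) = - br x y"
  using br_scale_right[OF assms, of "-1"] by simp

lemma br_leibniz:
  assumes "x \<in> graded_space scale gr" "y \<in> graded_space scale gr" "z \<in> graded_space scale gr"
  shows "br x (br y z) = br (br x y) z + br y (br x z)"
proof -
  have "br x (br y z) = - br y (br z x) - br z (br x y)"
    using jacobi[OF assms] by (simp add: eq_neg_iff_add_eq_0 algebra_simps)
  moreover have "br y (br z x) = - br y (br x z)"
    using assms by (simp add: br_swap[of z x] br_minus_right br_closed)
  moreover have "br z (br x y) = - br (br x y) z"
    using assms by (intro br_swap br_closed)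
  ultimately show ?thesis by simp
qed

end

context transitive_prolongation
begin

text \<open>An element of degree zero is the same thing as the derivation of \<open>\<mm>\<close> by which it acts.\<close>

definition realises :: "'g \<Rightarrow> ('v \<Rightarrow> 'v) \<Rightarrow> ('w \<Rightarrow> 'w) \<Rightarrow> bool" where
  "realises X A S \<longleftrightarrow> X \<in> gr 0 \<and> m_derivation A S \<and>
     (\<forall>v. br X (emb (v, 0)) = emb (A v, 0)) \<and> (\<forall>s. br X (emb (0, s)) = emb (0, S s))"

lemma emb_eq_iff: "emb x = emb y \<longleftrightarrow> x = y"
  using emb_inj by (simp add: inj_eq)

lemmas in_space = emb_in_graded_space gr_in_graded_space[of _ 0]

lemma ex_realises:
  assumes X: "X \<in> gr 0"
  shows "\<exists>A S. realises X A S"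
proof -
  have "br X (emb (v, 0)) \<in> emb ` m_gr (-2)" for v
    using br_gr[OF X emb_in_gr(1), of v] emb_negative[of "-2"] by simp
  then have "\<exists>u. br X (emb (v, 0)) = emb (u, 0)" for v
    by (auto simp: m_gr_def)
  then obtain A where A: "br X (emb (v, 0)) = emb (A v, 0)" for v
    by metis
  have "br X (emb (0, s)) \<in> emb ` m_gr (-1)" for s
    using br_gr[OF X emb_in_gr(2), of s] emb_negative[of "-1"] by simp
  then have "\<exists>t. br X (emb (0, s)) = emb (0, t)" for s
    by (auto simp: m_gr_def)
  then obtain S where S: "br X (emb (0, s)) = emb (0, S s)" for s
    by metis
  note [simp] = in_space(1) in_space(2)[OF X]
  have "A (v + u) = A v + A u" for v u
  proof -
    have "emb (A (v + u), 0) = br X (emb (v, 0) + emb (u, 0))"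
      by (simp flip: A emb_add)
    also have "\<dots> = emb (A v + A u, 0)"
      by (subst br_add_right) (simp_all add: A flip: emb_add)
    finally show ?thesis by (simp add: emb_eq_iff)
  qed
  moreover have "A (scaleV c v) = scaleV c (A v)" for c v
  proof -
    have "emb (A (scaleV c v), 0) = br X (scale c (emb (v, 0)))"
      by (simp add: m_scale_def flip: A emb_scale)
    also have "\<dots> = emb (scaleV c (A v), 0)"
      by (subst br_scale_right) (simp_all add: A m_scale_def flip: emb_scale)
    finally show ?thesis by (simp add: emb_eq_iff)
  qed
  moreover have "S (s + t) = S s + S t" for s t
  proof -
    have "emb (0, S (s + t)) = br X (emb (0, s) + emb (0, t))"
      by (simp flip: S emb_add)
    also have "\<dots> = emb (0, S s + S t)"
      by (subst br_add_right) (simp_all add: S flip: emb_add)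
    finally show ?thesis by (simp add: emb_eq_iff)
  qed
  moreover have "S (scaleW c s) = scaleW c (S s)" for c s
  proof -
    have "emb (0, S (scaleW c s)) = br X (scale c (emb (0, s)))"
      by (simp add: m_scale_def flip: S emb_scale)
    also have "\<dots> = emb (0, scaleW c (S s))"
      by (subst br_scale_right) (simp_all add: S m_scale_def flip: emb_scale)
    finally show ?thesis by (simp add: emb_eq_iff)
  qed
  moreover have "A (bracketW s t) = bracketW (S s) t + bracketW s (S t)" for s t
  proof -
    have br: "br (emb (0, s)) (emb (0, t)) = emb (bracketW s t, 0)" for s t
      by (simp add: m_br_def flip: emb_br)
    have "emb (A (bracketW s t), 0) = br X (br (emb (0, s)) (emb (0, t)))"
      by (simp add: br A)
    also have "\<dots> = br (emb (0, S s)) (emb (0, t)) + br (emb (0, s)) (emb (0, S t))"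
      by (simp add: br_leibniz S)
    also have "\<dots> = emb (bracketW (S s) t + bracketW s (S t), 0)"
      by (simp add: br flip: emb_add)
    finally show ?thesis by (simp add: emb_eq_iff)
  qed
  ultimately have "realises X A S"
    by (simp add: realises_def X A S m_derivation_def Vector_Spaces.linear_iff
        V.vector_space_axioms W.vector_space_axioms)
  then show ?thesis by blast
qed

lemma realises_derivation: "realises X A S \<Longrightarrow> m_derivation A S"
  and realises_gr: "realises X A S \<Longrightarrow> X \<in> gr 0"
  by (simp_all add: realises_def)

lemma realises_add:
  "realises X A S \<Longrightarrow> realises Y B T \<Longrightarrow> realises (X + Y) (\<lambda>v. A v + B v) (\<lambda>s. S s + T s)"
  by (simp add: realises_def m_derivation_add subspace_add[OF gr_subspace] br_add_left in_space
      flip: emb_add)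

lemma realises_scale:
  "realises X A S \<Longrightarrow> realises (scale c X) (\<lambda>v. scaleV c (A v)) (\<lambda>s. scaleW c (S s))"
  by (simp add: realises_def m_derivation_scale subspace_scale[OF gr_subspace] br_scale_left
      in_space m_scale_def flip: emb_scale)

lemma realises_br:
  assumes "realises X A S" "realises Y B T"
  shows "realises (br X Y) (\<lambda>v. A (B v) - B (A v)) (\<lambda>s. S (T s) - T (S s))"
proof -
  have emb_diff: "emb (x - y) = emb x - emb y" for x y
    using emb_add[of "x - y" y] by simp
  have XY: "X \<in> gr 0" "Y \<in> gr 0"
    using assms by (simp_all add: realises_def)
  have "br (br X Y) z = br X (br Y z) - br Y (br X z)" if "z \<in> graded_space scale gr" for z
    using br_leibniz[of X Y z] that XY by (simp add: in_space)
  then show ?thesis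
    using assms br_gr[OF XY]
    by (simp add: realises_def m_derivation_commutator in_space emb_diff[symmetric])
qed

text \<open>Transitivity compares elements by their action on \<open>W\<close> alone.\<close>

lemma realises_determined_on_W:
  assumes X: "realises X A S" and Y: "realises Y B S"
  shows "X = Y"
proof -
  have "realises (X + scale (-1) Y) (\<lambda>v. A v + scaleV (-1) (B v)) (\<lambda>s. S s + scaleW (-1) (S s))"
    by (intro realises_add realises_scale X Y)
  then have r: "X - Y \<in> gr 0" "br (X - Y) (emb (0, s)) = emb 0" for s
    by (simp_all add: realises_def zero_prod_def)
  have "emb 0 = 0"
    using emb_add[of 0 0] by simp
  moreover have "gr (-1) = emb ` m_gr (-1)"
    using emb_negative[of "-1"] by simp
  ultimately have "br (X - Y) Z = 0" if "Z \<in> gr (-1)" for Z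
    using that r(2) by (auto simp: m_gr_def)
  then have "X - Y = 0"
    using transitive[of 0 "X - Y"] r(1) by blast
  then show ?thesis by simp
qed

lemma realises_same_action:
  assumes "realises X A S" "realises X B T"
  shows "A = B" "S = T"
  using assms emb_eq_iff by (auto simp: realises_def fun_eq_iff)

end

text \<open>Maximality enters the description of \<open>\<gg>\<^sub>0\<close> only through this: every derivation of
  degree 0 occurs in it.\<close>

locale full_prolongation =
  transitive_prolongation scaleV form scaleW act beta scale br gr emb +
  char_zero_translation_algebra scaleV form scaleW act beta
  for scaleV :: "'k::field \<Rightarrow> 'v::ab_group_add \<Rightarrow> 'v" and form :: "'v \<Rightarrow> 'v \<Rightarrow> 'k"
    and scaleW :: "'k \<Rightarrow> 'w::ab_group_add \<Rightarrow> 'w"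
    and act :: "('v, 'k) free_algebra set \<Rightarrow> 'w \<Rightarrow> 'w"
    and beta :: "'w \<Rightarrow> 'w \<Rightarrow> 'k"
    and scale :: "'k \<Rightarrow> 'g::ab_group_add \<Rightarrow> 'g" and br :: "'g \<Rightarrow> 'g \<Rightarrow> 'g"
    and gr :: "int \<Rightarrow> 'g set" and emb :: "'v \<times> 'w \<Rightarrow> 'g" +
  assumes derivation_realised: "m_derivation A S \<Longrightarrow> \<exists>X. realises X A S"
begin

definition so_emb :: "('v \<Rightarrow> 'v) \<Rightarrow> 'g" where
  "so_emb A = (SOME X. realises X A (spin A))"

definition grading_element :: 'g where
  "grading_element = (SOME X. realises X (scaleV (-2)) (scaleW (-1)))"

lemma realises_so_emb: "A \<in> so \<Longrightarrow> realises (so_emb A) A (spin A)"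
  unfolding so_emb_def by (rule someI_ex[OF derivation_realised[OF m_derivation_spin]])

lemma realises_grading_element: "realises grading_element (scaleV (-2)) (scaleW (-1))"
  unfolding grading_element_def by (rule someI_ex[OF derivation_realised[OF m_derivation_grading]])

lemma so_emb_eqI: "A \<in> so \<Longrightarrow> realises X A (spin A) \<Longrightarrow> so_emb A = X"
  using realises_determined_on_W realises_so_emb by blast

lemma so_emb_commutator:
  assumes "A \<in> so" "B \<in> so"
  shows "so_emb (\<lambda>v. A (B v) - B (A v)) = br (so_emb A) (so_emb B)"
proof (rule so_emb_eqI[OF so_commutator[OF assms]])
  have "spin (\<lambda>v. A (B v) - B (A v)) = (\<lambda>s. spin A (spin B s) - spin B (spin A s))"
    by (intro spin_eqI spin_graph_commutator spin_graph_spin assms)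
  then show "realises (br (so_emb A) (so_emb B)) (\<lambda>v. A (B v) - B (A v))
      (spin (\<lambda>v. A (B v) - B (A v)))"
    using realises_br[OF assms[THEN realises_so_emb]] by simp
qed

lemma so_emb_add:
  assumes "A \<in> so" "B \<in> so"
  shows "(\<lambda>v. A v + B v) \<in> so" "so_emb (\<lambda>v. A v + B v) = so_emb A + so_emb B"
proof -
  note g = spin_graph.add[OF assms[THEN spin_graph_spin]]
  show *: "(\<lambda>v. A v + B v) \<in> so"
    by (rule spin_graph_in_so[OF g])
  show "so_emb (\<lambda>v. A v + B v) = so_emb A + so_emb B"
    using realises_add[OF assms[THEN realises_so_emb]]
    by (intro so_emb_eqI[OF *]) (simp add: spin_eqI[OF g])
qed

lemma so_emb_scale:
  assumes "A \<in> so"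
  shows "(\<lambda>v. scaleV c (A v)) \<in> so" "so_emb (\<lambda>v. scaleV c (A v)) = scale c (so_emb A)"
proof -
  note g = spin_graph.scale[OF assms[THEN spin_graph_spin], of c]
  show *: "(\<lambda>v. scaleV c (A v)) \<in> so"
    by (rule spin_graph_in_so[OF g])
  show "so_emb (\<lambda>v. scaleV c (A v)) = scale c (so_emb A)"
    using realises_scale[OF assms[THEN realises_so_emb], of c]
    by (intro so_emb_eqI[OF *]) (simp add: spin_eqI[OF g])
qed

lemma is_so_embedding_so_emb: "is_so_embedding so_emb"
  unfolding is_so_embedding_def
proof (intro conjI ballI allI)
  show "so_emb ` so \<subseteq> gr 0"
    using realises_so_emb realises_gr by blast
  show "inj_on so_emb so"
    using realises_so_emb realises_same_action(1) by (metis inj_onI)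
qed (use realises_so_emb in \<open>simp_all add: so_emb_add so_emb_scale so_emb_commutator realises_def\<close>)

lemma is_grading_element_grading_element: "is_grading_element grading_element"
proof -
  have "emb (scaleV (-2) v, 0) = scale (-2) (emb (v, 0))"
    "emb (0, scaleW (-1) s) = scale (-1) (emb (0, s))" for v s
    by (simp_all only: m_scale_def fst_conv snd_conv V.scale_zero_right W.scale_zero_right
        flip: emb_scale)
  then show ?thesis
    using realises_grading_element by (simp only: is_grading_element_def realises_def) simp
qed

lemma h0_iff: "X \<in> h0 \<longleftrightarrow> (\<exists>S. realises X (\<lambda>v. 0) S)"
proof
  assume X: "X \<in> h0"
  then have "X \<in> gr 0"
    by (simp add: h0_def)
  then obtain A S where AS: "realises X A S"
    using ex_realises by blast
  have "emb (0, 0) = 0"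
    using emb_add[of 0 0] by (simp add: zero_prod_def)
  then have "emb (A v, 0) = emb (0, 0)" for v
    using X AS by (simp add: h0_def realises_def)
  then have "A = (\<lambda>v. 0)"
    by (simp add: emb_eq_iff fun_eq_iff)
  with AS show "\<exists>S. realises X (\<lambda>v. 0) S" by blast
next
  have "emb (0, 0) = 0"
    using emb_add[of 0 0] by (simp add: zero_prod_def)
  then show "\<exists>S. realises X (\<lambda>v. 0) S \<Longrightarrow> X \<in> h0"
    by (auto simp: realises_def h0_def)
qed

lemma realises_zero: "realises X (\<lambda>v. 0) (\<lambda>s. 0) \<Longrightarrow> X = 0"
  using realises_determined_on_W[of X _ "\<lambda>s. 0" 0]
    realises_scale[OF realises_grading_element, of 0] by simp

lemma grading_element_central:
  assumes "X \<in> gr 0"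
  shows "br X grading_element = 0"
proof -
  obtain A S where AS: "realises X A S"
    using ex_realises[OF assms] by blast
  interpret A: Vector_Spaces.linear scaleV scaleV A
    using realises_derivation[OF AS] by (simp add: m_derivation_def)
  interpret S: Vector_Spaces.linear scaleW scaleW S
    using realises_derivation[OF AS] by (simp add: m_derivation_def)
  show ?thesis
    using realises_br[OF AS realises_grading_element]
    by (intro realises_zero) (simp add: A.scale S.scale del: V.scale_minus_left W.scale_minus_left)
qed

text \<open>The bracket acts on \<open>V\<close> by zero and on \<open>W\<close> by the commutator with \<open>spin A\<close>, a linear
  combination of products of two vectors, with which the operator on \<open>W\<close> commutes.\<close>

lemma h0_so_emb_commute:
  assumes "X \<in> h0" "A \<in> so"
  shows "br X (so_emb A) = 0"
proof -
  obtain S where S: "realises X (\<lambda>v. 0) S"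
    using assms(1) by (auto simp: h0_iff)
  interpret A: Vector_Spaces.linear scaleV scaleV A
    using assms(2) by (simp add: so_def)
  show ?thesis
    using realises_br[OF S realises_so_emb[OF assms(2)]]
    by (intro realises_zero)
      (simp add: vertical_derivation_spin_graph[OF spin_graph_spin[OF assms(2)]
          realises_derivation[OF S]])
qed

lemma scalar_in_so:
  assumes "(\<lambda>v. scaleV k v) \<in> so"
  shows "k = 0"
proof -
  obtain u where u: "form u u \<noteq> 0"
    using ex_nonnull by blast
  have "2 * (k * form u u) = 0"
    using soD(3)[OF assms, of u u] by (simp add: VF.scale_left VF.scale_right)
  then show ?thesis
    using u two_nonzero by simp
qed

lemma ex_decomposition:
  assumes "X \<in> gr 0"
  shows "\<exists>A\<in>so. \<exists>k. \<exists>D\<in>h0. X = so_emb A + scale k grading_element + D"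
proof -
  obtain A S where AS: "realises X A S"
    using ex_realises[OF assms] by blast
  obtain k where k: "(\<lambda>v. A v - scaleV k v) \<in> so"
    using m_derivation_so_part[OF realises_derivation[OF AS]] by blast
  let ?A = "\<lambda>v. A v - scaleV k v"
  \<comment> \<open>\<open>E\<close> acts on \<open>V\<close> as \<open>-2\<close>, so the scalar \<open>k\<close> is the action of \<open>- k / 2\<close> times \<open>E\<close>\<close>
  define D where "D = X + scale (-1) (so_emb ?A + scale (- k / 2) grading_element)"
  have "\<exists>T. realises D (\<lambda>v. A v + scaleV (-1) (?A v + scaleV (- k / 2) (scaleV (-2) v))) T"
    unfolding D_def
    by (rule exI, rule realises_add[OF AS realises_scale[OF realises_add[OF realises_so_emb[OF k]
          realises_scale[OF realises_grading_element]]]])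
  moreover have "A v + scaleV (-1) (?A v + scaleV (- k / 2) (scaleV (-2) v)) = 0" for v
    using two_nonzero by simp
  ultimately have "D \<in> h0"
    by (simp only: h0_iff)
  moreover have "X = so_emb ?A + scale (- k / 2) grading_element + D"
    by (simp add: D_def)
  ultimately show ?thesis
    using k by blast
qed

text \<open>On \<open>V\<close> the elements of \<open>\<hh>\<^sub>0\<close> act by zero, and the action is faithful on \<open>so(V) + K E\<close>, since a scalar that is
  skew for the form is zero.\<close>

lemma decomposition_unique:
  assumes eq: "so_emb A + scale k grading_element + D = so_emb A' + scale k' grading_element + D'"
    and so: "A \<in> so" "A' \<in> so" and h0: "D \<in> h0" "D' \<in> h0"
  shows "A = A'" "k = k'" "D = D'"
proof -
  obtain T T' where T: "realises D (\<lambda>v. 0) T" "realises D' (\<lambda>v. 0) T'"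
    using h0 by (auto simp: h0_iff)
  have r: "realises (so_emb A + scale k grading_element + D)
      (\<lambda>v. A v + scaleV k (scaleV (-2) v) + 0) (\<lambda>s. spin A s + scaleW k (scaleW (-1) s) + T s)"
    if "A \<in> so" "realises D (\<lambda>v. 0) T" for A k D T
    by (intro realises_add realises_scale realises_so_emb realises_grading_element that)
  have same: "(\<lambda>v. A v + scaleV k (scaleV (-2) v) + 0) = (\<lambda>v. A' v + scaleV k' (scaleV (-2) v) + 0)"
    by (rule realises_same_action(1)[OF r[OF so(1) T(1), of k] r[OF so(2) T(2), of k', folded eq]])
  have act: "A v + scaleV (k * -2) v = A' v + scaleV (k' * -2) v" for v
    using fun_cong[OF same, of v] by simp
  have "(\<lambda>v. A v + scaleV (-1) (A' v)) \<in> so"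
    by (intro so_emb_add(1) so_emb_scale(1) so)
  moreover have "A v + scaleV (-1) (A' v) = scaleV (2 * (k - k')) v" for v
  proof -
    have "A v - A' v = scaleV (k' * -2) v - scaleV (k * -2) v"
      using act[of v] by (simp add: algebra_simps)
    then show ?thesis
      by (simp add: algebra_simps flip: V.scale_left_diff_distrib)
  qed
  ultimately have "2 * (k - k') = 0"
    by (intro scalar_in_so) simp
  then show k: "k = k'"
    using two_nonzero by simp
  then show A: "A = A'"
    using act by auto
  show "D = D'"
    using eq by (simp add: k A)
qed

lemma subspace_h0: "subspace h0"
proof (rule subspaceI)
  show "0 \<in> h0"
    using realises_scale[OF realises_grading_element, of 0] by (auto simp: h0_iff)
  show "x + y \<in> h0" if "x \<in> h0" "y \<in> h0" for x y
    using that realises_add[of x "\<lambda>v. 0" _ y "\<lambda>v. 0"] by (auto simp: h0_iff)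
  show "scale c x \<in> h0" if "x \<in> h0" for c x
    using that realises_scale[of x "\<lambda>v. 0" _ c] by (auto simp: h0_iff)
qed

lemma lie_ideal_h0: "lie_ideal scale br (gr 0) h0"
  unfolding lie_ideal_def
proof (intro conjI ballI)
  show "h0 \<subseteq> gr 0"
    by (auto simp: h0_def)
  show "subspace h0"
    by (rule subspace_h0)
  fix x y assume x: "x \<in> gr 0" and y: "y \<in> h0"
  obtain A S where AS: "realises x A S"
    using ex_realises[OF x] by blast
  interpret A: Vector_Spaces.linear scaleV scaleV A
    using realises_derivation[OF AS] by (simp add: m_derivation_def)
  obtain T where "realises y (\<lambda>v. 0) T"
    using y by (auto simp: h0_iff)
  from realises_br[OF AS this] show "br x y \<in> h0"
    by (auto simp: h0_iff A.zero)
qed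

lemma lie_ideal_grading_element:
  "lie_ideal scale br (gr 0) (range (\<lambda>c. scale c grading_element))"
  unfolding lie_ideal_def
proof (intro conjI ballI)
  note E = realises_gr[OF realises_grading_element]
  show "range (\<lambda>c. scale c grading_element) \<subseteq> gr 0"
    using subspace_scale[OF gr_subspace E] by blast
  show "subspace (range (\<lambda>c. scale c grading_element))"
    by (simp flip: span_singleton)
  show "br x y \<in> range (\<lambda>c. scale c grading_element)"
    if x: "x \<in> gr 0" and y: "y \<in> range (\<lambda>c. scale c grading_element)" for x y
  proof -
    have "br x y = 0"
      using y x E by (auto simp: br_scale_right grading_element_central in_space)
    then show ?thesis
      using rangeI[of "\<lambda>c. scale c grading_element" 0] by simp
  qed
qed

text \<open>By \<open>ex_decomposition\<close> only the bracket with elements of \<open>so(V)\<close> itself has to be considered: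
  the other two summands commute with \<open>so(V)\<close>.\<close>

lemma lie_ideal_so: "lie_ideal scale br (gr 0) (so_emb ` so)"
  unfolding lie_ideal_def
proof (intro conjI ballI)
  show sub: "so_emb ` so \<subseteq> gr 0"
    using realises_so_emb realises_gr by blast
  show "subspace (so_emb ` so)"
  proof (rule subspaceI)
    have "wedge 0 0 \<in> so"
      by (rule spin_graph_in_so[OF spin_graph_wedge])
    from so_emb_scale[OF this, of 0] show "0 \<in> so_emb ` so"
      by (metis imageI scale_zero_left)
    show "x + y \<in> so_emb ` so" if "x \<in> so_emb ` so" "y \<in> so_emb ` so" for x y
      using that by (elim imageE) (auto simp: so_emb_add(1) simp flip: so_emb_add(2))
    show "scale c x \<in> so_emb ` so" if "x \<in> so_emb ` so" for c x
      using that by (elim imageE) (auto simp: so_emb_scale(1) simp flip: so_emb_scale(2))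
  qed
  fix x y assume x: "x \<in> gr 0" and "y \<in> so_emb ` so"
  then obtain B where B: "B \<in> so" "y = so_emb B"
    by blast
  obtain A k D where d: "A \<in> so" "D \<in> h0" "x = so_emb A + scale k grading_element + D"
    using ex_decomposition[OF x] by blast
  have gr: "so_emb A \<in> gr 0" "y \<in> gr 0" "grading_element \<in> gr 0" "D \<in> gr 0"
    using sub d B realises_gr[OF realises_grading_element] by (auto simp: h0_def)
  note U = gr[THEN gr_in_graded_space]
  have "br grading_element y = 0"
    using grading_element_central[OF gr(2)] br_swap[OF U(3,2)] by simp
  then have "br x y = br (so_emb A) y"
    using h0_so_emb_commute[OF d(2) B(1)] U
    by (simp add: d(3) br_add_left br_scale_left B(2) subspace_add[OF subspace_graded_space]
        subspace_scale[OF subspace_graded_space])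
  also have "\<dots> = so_emb (\<lambda>v. A (B v) - B (A v))"
    by (simp add: so_emb_commutator[OF d(1) B(1)] B(2))
  finally show "br x y \<in> so_emb ` so"
    using so_commutator[OF d(1) B(1)] by blast
qed

lemma direct_sum:
  "direct_sum_of_three_ideals scale br (gr 0) (so_emb ` so)
    (range (\<lambda>c. scale c grading_element)) h0"
  unfolding direct_sum_of_three_ideals_def
proof (intro conjI ballI lie_ideal_so lie_ideal_grading_element lie_ideal_h0)
  fix x assume "x \<in> gr 0"
  then obtain A k D where d: "A \<in> so" "D \<in> h0" "x = so_emb A + scale k grading_element + D"
    using ex_decomposition by blast
  show "\<exists>!(a, b, c). a \<in> so_emb ` so \<and> b \<in> range (\<lambda>c. scale c grading_element) \<and> c \<in> h0 \<and>
      x = a + b + c"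
  proof (rule ex1I[of _ "(so_emb A, scale k grading_element, D)"])
    fix t
    assume t: "case t of (a, b, c) \<Rightarrow> a \<in> so_emb ` so \<and>
      b \<in> range (\<lambda>c. scale c grading_element) \<and> c \<in> h0 \<and> x = a + b + c"
    then obtain A' k' D' where t': "t = (so_emb A', scale k' grading_element, D')"
        "A' \<in> so" "D' \<in> h0" "x = so_emb A' + scale k' grading_element + D'"
      by (cases t) auto
    have "so_emb A' + scale k' grading_element + D' = so_emb A + scale k grading_element + D"
      using t'(4) d(3) by simp
    from decomposition_unique[OF this t'(2) d(1) t'(3) d(2)]
    show "t = (so_emb A, scale k grading_element, D)"
      by (simp add: t'(1))
  qed (use d in auto)
qed

end

text \<open>Transitivity bounds \<open>\<gg>\<^sub>0\<close> from above by \<open>Der(\<mm>)\<close>, maximality bounds it from below. The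
  homomorphism \<open>G\<close> from \<open>\<mm> + Der(\<mm>)\<close> to \<open>\<gg>\<close> may induce a nontrivial automorphism \<open>(Q, P)\<close> of
  \<open>\<mm>\<close>; this is compensated by conjugating the derivation with it.\<close>

lemma full_prolongation_if_maximal:
  fixes scaleV :: "'k::field \<Rightarrow> 'v::ab_group_add \<Rightarrow> 'v"
    and scaleW :: "'k \<Rightarrow> 'w::ab_group_add \<Rightarrow> 'w"
  assumes "char_zero_translation_algebra scaleV form scaleW act beta"
    and max: "maximal_transitive_prolongation scaleV form scaleW act beta scale br gr emb"
  shows "full_prolongation scaleV form scaleW act beta scale br gr emb"
proof -
  interpret char_zero_translation_algebra scaleV form scaleW act beta by (rule assms(1))
  interpret T: transitive_prolongation scaleV form scaleW act beta scale br gr emb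
    using max by (simp add: maximal_transitive_prolongation_def)
  interpret X: transitive_prolongation scaleV form scaleW act beta ext_scale ext_br ext_gr ext_emb
    by (rule transitive_prolongation_ext)
  have "fin_dim ext_scale (graded_space ext_scale ext_gr)"
    using fin_dim_ext X.fin_dim_subspace[OF X.subspace_graded_space] by blast
  from maximal_prolongation_receives[OF max transitive_prolongation_ext this]
  obtain G where G: "graded_lie_hom ext_scale ext_br ext_gr scale br gr G"
      and G_inj: "inj_on G (graded_space ext_scale ext_gr)"
    by blast
  let ?U = "graded_space ext_scale ext_gr"
  have G_add: "G (x + y) = G x + G y" and G_scale: "G (ext_scale c x) = scale c (G x)"
    and G_br: "G (ext_br x y) = br (G x) (G y)" if "x \<in> ?U" "y \<in> ?U" for x y c
    using G that unfolding graded_lie_hom_def by blast+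
  have G_gr: "G x \<in> gr p" if "x \<in> ext_gr p" for x p
    using G that unfolding graded_lie_hom_def by blast
  have U[simp]: "(v, w, 0, 0) \<in> ?U" for v w
    by (simp add: graded_space_ext m_derivation_0)

  have "\<exists>u. G (v, 0, 0, 0) = emb (u, 0)" for v
  proof -
    have "G (v, 0, 0, 0) \<in> emb ` m_gr (-2)"
      using G_gr[of "(v, 0, 0, 0)" "-2"] T.emb_negative[of "-2"]
      by (simp add: ext_gr_def m_derivation_0)
    then show ?thesis
      by (auto simp: m_gr_def)
  qed
  then obtain Q where Q: "G (v, 0, 0, 0) = emb (Q v, 0)" for v
    by metis
  have "\<exists>t. G (0, s, 0, 0) = emb (0, t)" for s
  proof -
    have "G (0, s, 0, 0) \<in> emb ` m_gr (-1)"
      using G_gr[of "(0, s, 0, 0)" "-1"] T.emb_negative[of "-1"]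
      by (simp add: ext_gr_def m_derivation_0)
    then show ?thesis
      by (auto simp: m_gr_def)
  qed
  then obtain P where P: "G (0, s, 0, 0) = emb (0, P s)" for s
    by metis

  have "emb (Q (v + u), 0) = emb (Q v + Q u, 0)" "emb (0, P (s + t)) = emb (0, P s + P t)"
    for v u s t
    using G_add[OF U U, of v 0 u 0] G_add[OF U U, of 0 s 0 t] by (simp_all add: Q P flip: T.emb_add)
  moreover have "emb (Q (scaleV c v), 0) = emb (scaleV c (Q v), 0)"
    "emb (0, P (scaleW c s)) = emb (0, scaleW c (P s))" for c v s
    using G_scale[OF U U, of c v 0] G_scale[OF U U, of c 0 s]
    by (simp_all add: ext_scale_def Q P m_scale_def zero_fun_def[symmetric] flip: T.emb_scale)
  ultimately have linQ: "Vector_Spaces.linear scaleV scaleV Q"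
    and linP: "Vector_Spaces.linear scaleW scaleW P"
    by (simp_all add: Vector_Spaces.linear_iff V.vector_space_axioms W.vector_space_axioms
        T.emb_eq_iff)
  interpret Q: Vector_Spaces.linear scaleV scaleV Q by (rule linQ)
  interpret P: Vector_Spaces.linear scaleW scaleW P by (rule linP)
  have injQ: "inj Q"
  proof (rule injI)
    fix v u assume "Q v = Q u"
    then have "G (v, 0, 0, 0) = G (u, 0, 0, 0)"
      by (simp add: Q)
    from inj_onD[OF G_inj this U U] show "v = u"
      by simp
  qed
  have injP: "inj P"
  proof (rule injI)
    fix s t assume "P s = P t"
    then have "G (0, s, 0, 0) = G (0, t, 0, 0)"
      by (simp add: P)
    from inj_onD[OF G_inj this U U] show "s = t"
      by simp
  qed
  obtain Q' where Q': "Q (Q' v) = v" "Q' (Q v) = v" for v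
    using VF.linear_inj_imp_surj[OF linQ injQ] injQ by (metis inv_f_f surj_f_inv_f)
  obtain P' where P': "P (P' s) = s" "P' (P s) = s" for s
    using WF.linear_inj_imp_surj[OF linP injP] injP by (metis inv_f_f surj_f_inv_f)
  have bracket: "Q (bracketW s t) = bracketW (P s) (P t)" for s t
  proof -
    have "emb (Q (bracketW s t), 0) = G (ext_br (0, s, 0, 0) (0, t, 0, 0))"
      by (simp add: ext_br_def zero_fun_def[symmetric] Q)
    also have "\<dots> = emb (m_br (0, P s) (0, P t))"
      by (simp add: G_br P T.emb_br)
    finally show ?thesis
      by (simp add: T.emb_eq_iff m_br_def)
  qed
  show ?thesis
  proof unfold_locales
    fix A S assume AS: "m_derivation A S"
    interpret A: Vector_Spaces.linear scaleV scaleV A using AS by (simp add: m_derivation_def)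
    interpret S: Vector_Spaces.linear scaleW scaleW S using AS by (simp add: m_derivation_def)
    \<comment> \<open>conjugation by the automorphism \<open>(Q, P)\<close>\<close>
    define A' where "A' v = Q' (A (Q v))" for v
    define S' where "S' s = P' (S (P s))" for s
    have QA': "Q (A' v) = A (Q v)" and PS': "P (S' s) = S (P s)" for v s
      by (simp_all add: A'_def S'_def Q' P')
    have A'_eqI: "A' x = y" if "A (Q x) = Q y" for x y
      using that Q' by (simp add: A'_def)
    have S'_eqI: "S' x = y" if "S (P x) = P y" for x y
      using that P' by (simp add: S'_def)
    have der: "m_derivation A' S'"
      unfolding m_derivation_def Vector_Spaces.linear_iff
    proof (intro conjI allI V.vector_space_axioms W.vector_space_axioms)
      show "A' (v + u) = A' v + A' u" "A' (scaleV c v) = scaleV c (A' v)" for v u c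
        by (rule A'_eqI; simp add: Q.add A.add Q.scale A.scale QA')+
      show "S' (s + t) = S' s + S' t" "S' (scaleW c s) = scaleW c (S' s)" for s t c
        by (rule S'_eqI; simp add: P.add S.add P.scale S.scale PS')+
      show "A' (bracketW s t) = bracketW (S' s) t + bracketW s (S' t)" for s t
        by (rule A'_eqI) (simp add: Q.add bracket PS' m_derivation_bracketW[OF AS])
    qed
    define Y where "Y = G (0, 0, A', S')"
    have U': "(0, 0, A', S') \<in> ?U"
      by (simp add: graded_space_ext der)
    have "Y \<in> gr 0"
      unfolding Y_def by (rule G_gr) (simp add: ext_gr_def der)
    moreover have "br Y (emb (v, 0)) = emb (A v, 0)" for v
    proof -
      have "br Y (emb (v, 0)) = br Y (G (Q' v, 0, 0, 0))"
        by (simp add: Q Q')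
      also have "\<dots> = G (ext_br (0, 0, A', S') (Q' v, 0, 0, 0))"
        unfolding Y_def by (simp add: G_br[OF U' U])
      also have "ext_br (0, 0, A', S') (Q' v, 0, 0, 0) = (A' (Q' v), 0, 0, 0)"
        by (simp add: ext_br_def fun_eq_iff m_derivation_at_0[OF der])
      finally show ?thesis
        by (simp add: Q QA' Q')
    qed
    moreover have "br Y (emb (0, s)) = emb (0, S s)" for s
    proof -
      have "br Y (emb (0, s)) = br Y (G (0, P' s, 0, 0))"
        by (simp add: P P')
      also have "\<dots> = G (ext_br (0, 0, A', S') (0, P' s, 0, 0))"
        unfolding Y_def by (simp add: G_br[OF U' U])
      also have "ext_br (0, 0, A', S') (0, P' s, 0, 0) = (0, S' (P' s), 0, 0)"
        by (simp add: ext_br_def fun_eq_iff m_derivation_at_0[OF der])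
      finally show ?thesis
        by (simp add: P PS' P')
    qed
    ultimately show "\<exists>X. T.realises X A S"
      using AS by (auto simp: T.realises_def)
  qed
qed

lemma field_iso_char_zero:
  fixes f :: "'k::field \<Rightarrow> 'a::field_char_0"
  assumes "field_iso f" and "of_nat n = (0 :: 'k)"
  shows "n = 0"
proof -
  have add: "f (x + y) = f x + f y" and one: "f 1 = 1" for x y
    using assms(1) by (simp_all add: field_iso_def)
  have zero: "f 0 = 0"
    using add[of 0 0] by simp
  have "f (of_nat m) = of_nat m" for m
    by (induction m) (simp_all add: zero one add)
  from this[of n] show ?thesis
    by (simp add: assms(2) zero)
qed

lemma real_or_complex_char_zero:
  assumes "real_or_complex TYPE('k::field)" and "of_nat n = (0 :: 'k)"
  shows "n = 0"
  using assms(1) unfolding real_or_complex_def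
  by (elim disjE exE) (erule field_iso_char_zero, rule assms(2))+

theorem theorem2p3:
  fixes scaleV :: "'k::field \<Rightarrow> 'v::ab_group_add \<Rightarrow> 'v"
    and form :: "'v \<Rightarrow> 'v \<Rightarrow> 'k"
    and scaleW :: "'k \<Rightarrow> 'w::ab_group_add \<Rightarrow> 'w"
    and act :: "('v, 'k) free_algebra set \<Rightarrow> 'w \<Rightarrow> 'w"
    and beta :: "'w \<Rightarrow> 'w \<Rightarrow> 'k"
    and scale :: "'k \<Rightarrow> 'g::ab_group_add \<Rightarrow> 'g"
    and br :: "'g \<Rightarrow> 'g \<Rightarrow> 'g"
    and gr :: "int \<Rightarrow> 'g set"
    and emb :: "'v \<times> 'w \<Rightarrow> 'g"
  assumes "real_or_complex TYPE('k)"
    and "extended_translation_algebra scaleV form scaleW act beta"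
    and "maximal_transitive_prolongation scaleV form scaleW act beta scale br gr emb"
  shows "\<exists>phi E.
    transitive_prolongation.is_so_embedding scaleV form scaleW act scale br gr emb phi \<and>
    transitive_prolongation.is_grading_element scale br gr emb E \<and>
    direct_sum_of_three_ideals scale br (gr 0)
      (phi ` quadratic_space.so scaleV form)
      (range (\<lambda>c. scale c E))
      (transitive_prolongation.h0 br gr emb)"
proof -
  interpret extended_translation_algebra scaleV form scaleW act beta
    by (rule assms(2))
  have "char_zero_translation_algebra scaleV form scaleW act beta"
    by unfold_locales (rule real_or_complex_char_zero[OF assms(1)])
  then interpret F: full_prolongation scaleV form scaleW act beta scale br gr emb
    by (rule full_prolongation_if_maximal[OF _ assms(3)])
  show ?thesis
    using F.is_so_embedding_so_emb F.is_grading_element_grading_element F.direct_sum by blast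
qed

end
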